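(* Let $R$ be a ring and $M$ a nonzero right $R$-module. For each $n\ge 0$ define an operator $\mathrm{cl}_{R^n}$ on subsets of $R^n$ by $$\mathrm{cl}_{R^n}(S)=\{x\in R^n \mid \mathrm{ann}_{M^n}(x)\supseteq \mathrm{ann}_{M^n}(S)\}\qquad (S\subseteq R^n).$$ Then this family of operators satisfies the following three conditions: (1) for every $n\ge 0$, $\mathrm{cl}_{R^n}$ is a closure operator on the underlying set of the right $R$-module $R^n$, and its closed subsets are $R$-submodules; (2) for all $n>0$, $\mathrm{cl}_{R^n}(\emptyset)$ is a proper submodule of $R^n$; (3) for all $m,n\ge 0$, every homomorphism of right $R$-modules $h:R^m\to R^n$ and every $\mathrm{cl}_{R^n}$-closed submodule $A\subseteq R^n$, the submodule $h^{-1}(A)\subseteq R^m$ is $\mathrm{cl}_{R^m}$-closed. Moreover, for each $n\geq 0$, the condition that $\mathrm{cl}_{R^n}$ have the exchange property (4) for all $S\subseteq R^n$ and $t,u\in R^n$, if $u\notin \mathrm{cl}_{R^n}(S)$ but $u\in \mathrm{cl}_{R^n}(S\cup\{t\})$, then $t\in \mathrm{cl}_{R^n}(S\cup\{u\})$ is equivalent to each of the following three statements: (a) there do not exist a subset $S\subseteq R^n$ and elements $u,t\in R^n$ such that $\mathrm{ann}_{M^n}(S)\supsetneqq \mathrm{ann}_{M^n}(S\cup\{u\})\supsetneqq \mathrm{ann}_{M^n}(S\cup\{t\})$; (b) there do not exist an $n\times (n-1)$ matrix $A$ over $R$, and $n\times n$ matrices $B$, $C$ over $R$, each obtained by adding a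 single column to $A$, such that $\mathrm{ann}_{M^n}(A)\supsetneqq \mathrm{ann}_{M^n}(B)\supsetneqq \mathrm{ann}_{M^n}(C)$; (c) there do not exist $n\times n$ matrices $A,B,C$ over $R$ which all agree except in one column, such that $\mathrm{ann}_{M^n}(A)\supsetneqq \mathrm{ann}_{M^n}(B)\supsetneqq \mathrm{ann}_{M^n}(C)$. Hence, if a ring $R$ has a faithful (nonzero) right module $M$ which for all $n\ge 0$ satisfies (a), equivalently (b), equivalently (c), then $R$ is embeddable in a division ring.
   Context: Rings are associative with $1$, not necessarily commutative; ring homomorphisms preserve $1$; modules are unital. "Embeddable in a division ring" means there is an injective ring homomorphism into a division ring. A closure operator on a set $X$ is a map $\mathrm{cl}$ from subsets of $X$ to subsets of $X$ such that for all $S,T\subseteq X$: $S\subseteq T\Rightarrow \mathrm{cl}(S)\subseteq \mathrm{cl}(T)$; $\mathrm{cl}(S)\supseteq S$; $\mathrm{cl}(\mathrm{cl}(S))=\mathrm{cl}(S)$. A subset is closed if it equals its closure. Elements of $M^n$ are written as row vectors and elements of $R^n$ as column vectors; for $a\in M^n$, $x\in R^n$, $ax=\sum_i a_ix_i\in M$. For $S\subseteq R^n$, $\mathrm{ann}_{M^n}(S)=\{a\in M^n\mid as=0 \text{ for all } s\in S\}$, and $\mathrm{ann}_{M^n}(x)=\mathrm{ann}_{M^n}(\{x\})$. For a matrix $A$ over $R$ with $n$ rows, $\mathrm{ann}_{M^n}(A)$ is the set of $a\in M^n$ with $aA=0$, i.e. the annihilator in $M^n$ of the set of columns of $A$. For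 $n=1$, an $n\times(n-1)$ matrix is the empty $1\times 0$ matrix, whose annihilator is all of $M$. For $n=0$ condition (b) is understood to hold vacuously. *)

theory Defs
  imports
    "Jordan_Normal_Form.Matrix"
    "Jordan_Normal_Form.VS_Connect"
    "HOL-Algebra.Subrings"
    "HOL-Algebra.Weak_Morphisms"
begin

text \<open>
  The base ring \<open>R\<close> is a type \<open>'r\<close> of class \<^class>\<open>ring_1\<close>, hence associative, unital and not
  necessarily commutative.  That class demands \<open>0 \<noteq> 1\<close>, which loses nothing here, since a ring
  with a nonzero unital module is nonzero.  The sets \<open>R\<^sup>n\<close> and \<open>M\<^sup>n\<close> are \<open>carrier_vec n\<close>.
  The scalar multiplication of vectors in the library acts from the left, so the right module
  structure of \<open>R\<^sup>n\<close> is introduced separately.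
\<close>


section \<open>Right modules\<close>

locale right_module =
  fixes act :: "'m::ab_group_add \<Rightarrow> 'r::ring_1 \<Rightarrow> 'm"
  assumes add_act: "act (a + b) r = act a r + act b r"
    and act_add: "act a (r + s) = act a r + act a s"
    and act_mult: "act a (r * s) = act (act a r) s"
    and act_one: "act a 1 = a"

definition faithful_action :: "('m::ab_group_add \<Rightarrow> 'r::ring_1 \<Rightarrow> 'm) \<Rightarrow> bool" where
  "faithful_action act \<longleftrightarrow> (\<forall>r. (\<forall>a. act a r = 0) \<longrightarrow> r = 0)"

definition vec_rscale :: "'r::ring_1 vec \<Rightarrow> 'r \<Rightarrow> 'r vec" where
  "vec_rscale x r = map_vec (\<lambda>c. c * r) x"

definition right_submodule :: "nat \<Rightarrow> 'r::ring_1 vec set \<Rightarrow> bool" where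
  "right_submodule n A \<longleftrightarrow>
     A \<subseteq> carrier_vec n \<and> 0\<^sub>v n \<in> A \<and>
     (\<forall>x\<in>A. \<forall>y\<in>A. x + y \<in> A) \<and>
     (\<forall>x\<in>A. \<forall>r. vec_rscale x r \<in> A)"

definition right_module_hom :: "nat \<Rightarrow> nat \<Rightarrow> ('r::ring_1 vec \<Rightarrow> 'r vec) \<Rightarrow> bool" where
  "right_module_hom m n h \<longleftrightarrow>
     h \<in> carrier_vec m \<rightarrow> carrier_vec n \<and>
     (\<forall>x\<in>carrier_vec m. \<forall>y\<in>carrier_vec m. h (x + y) = h x + h y) \<and>
     (\<forall>x\<in>carrier_vec m. \<forall>r. h (vec_rscale x r) = vec_rscale (h x) r)"


section \<open>Annihilators and the closure operators\<close>

text \<open>The product \<open>a x\<close> of a row \<open>a \<in> M\<^sup>n\<close> with a column \<open>x \<in> R\<^sup>n\<close>.\<close>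

definition row_col ::
  "('m::ab_group_add \<Rightarrow> 'r::ring_1 \<Rightarrow> 'm) \<Rightarrow> 'm vec \<Rightarrow> 'r vec \<Rightarrow> 'm" where
  "row_col act a x = (\<Sum>i<dim_vec x. act (a $ i) (x $ i))"

text \<open>The product \<open>a A\<close> of a row \<open>a \<in> M\<^sup>n\<close> with a matrix having \<open>n\<close> rows.\<close>

definition row_mat ::
  "('m::ab_group_add \<Rightarrow> 'r::ring_1 \<Rightarrow> 'm) \<Rightarrow> 'm vec \<Rightarrow> 'r mat \<Rightarrow> 'm vec" where
  "row_mat act a A = vec (dim_col A) (\<lambda>j. row_col act a (col A j))"

definition ann ::
  "('m::ab_group_add \<Rightarrow> 'r::ring_1 \<Rightarrow> 'm) \<Rightarrow> nat \<Rightarrow> 'r vec set \<Rightarrow> 'm vec set" where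
  "ann act n S = {a \<in> carrier_vec n. \<forall>s\<in>S. row_col act a s = 0}"

definition ann_mat ::
  "('m::ab_group_add \<Rightarrow> 'r::ring_1 \<Rightarrow> 'm) \<Rightarrow> 'r mat \<Rightarrow> 'm vec set" where
  "ann_mat act A = {a \<in> carrier_vec (dim_row A). row_mat act a A = 0\<^sub>v (dim_col A)}"

definition cl ::
  "('m::ab_group_add \<Rightarrow> 'r::ring_1 \<Rightarrow> 'm) \<Rightarrow> nat \<Rightarrow> 'r vec set \<Rightarrow> 'r vec set" where
  "cl act n S = {x \<in> carrier_vec n. ann act n S \<subseteq> ann act n {x}}"

definition closure_operator_on :: "'a set \<Rightarrow> ('a set \<Rightarrow> 'a set) \<Rightarrow> bool" where
  "closure_operator_on X c \<longleftrightarrow>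
     (\<forall>S. S \<subseteq> X \<longrightarrow> c S \<subseteq> X) \<and>
     (\<forall>S T. S \<subseteq> T \<and> T \<subseteq> X \<longrightarrow> c S \<subseteq> c T) \<and>
     (\<forall>S. S \<subseteq> X \<longrightarrow> S \<subseteq> c S) \<and>
     (\<forall>S. S \<subseteq> X \<longrightarrow> c (c S) = c S)"

definition closed_subset :: "'a set \<Rightarrow> ('a set \<Rightarrow> 'a set) \<Rightarrow> 'a set \<Rightarrow> bool" where
  "closed_subset X c A \<longleftrightarrow> A \<subseteq> X \<and> c A = A"

definition exchange_property :: "'a set \<Rightarrow> ('a set \<Rightarrow> 'a set) \<Rightarrow> bool" where
  "exchange_property X c \<longleftrightarrow>
     (\<forall>S t u. S \<subseteq> X \<and> t \<in> X \<and> u \<in> X \<and> u \<notin> c S \<and> u \<in> c (S \<union> {t}) \<longrightarrow> t \<in> c (S \<union> {u}))"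


section \<open>The chain conditions on annihilators\<close>

definition no_set_chain ::
  "('m::ab_group_add \<Rightarrow> 'r::ring_1 \<Rightarrow> 'm) \<Rightarrow> nat \<Rightarrow> bool" where
  "no_set_chain act n \<longleftrightarrow>
     \<not> (\<exists>S u t. S \<subseteq> carrier_vec n \<and> u \<in> carrier_vec n \<and> t \<in> carrier_vec n \<and>
          ann act n S \<supset> ann act n (S \<union> {u}) \<and>
          ann act n (S \<union> {u}) \<supset> ann act n (S \<union> {t}))"

text \<open>The added column may be inserted at any position.\<close>

definition adds_column :: "'r mat \<Rightarrow> 'r mat \<Rightarrow> bool" where
  "adds_column A B \<longleftrightarrow>
     dim_row B = dim_row A \<and> (\<exists>xs v ys. cols A = xs @ ys \<and> cols B = xs @ [v] @ ys)"

definition no_added_column_chain ::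
  "('m::ab_group_add \<Rightarrow> 'r::ring_1 \<Rightarrow> 'm) \<Rightarrow> nat \<Rightarrow> bool" where
  "no_added_column_chain act n \<longleftrightarrow>
     (n > 0 \<longrightarrow>
       \<not> (\<exists>A B C. A \<in> carrier_mat n (n - 1) \<and> B \<in> carrier_mat n n \<and> C \<in> carrier_mat n n \<and>
            adds_column A B \<and> adds_column A C \<and>
            ann_mat act A \<supset> ann_mat act B \<and> ann_mat act B \<supset> ann_mat act C))"

definition no_changed_column_chain ::
  "('m::ab_group_add \<Rightarrow> 'r::ring_1 \<Rightarrow> 'm) \<Rightarrow> nat \<Rightarrow> bool" where
  "no_changed_column_chain act n \<longleftrightarrow>
     \<not> (\<exists>A B C. A \<in> carrier_mat n n \<and> B \<in> carrier_mat n n \<and> C \<in> carrier_mat n n \<and>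
          (\<exists>j<n. \<forall>k<n. k \<noteq> j \<longrightarrow> col A k = col B k \<and> col B k = col C k) \<and>
          ann_mat act A \<supset> ann_mat act B \<and> ann_mat act B \<supset> ann_mat act C)"


section \<open>Embeddability in a division ring\<close>

definition skew_field :: "('a, 'b) ring_scheme \<Rightarrow> bool" where
  "skew_field D \<longleftrightarrow> ring D \<and> Units D = carrier D - {\<zero>\<^bsub>D\<^esub>}"

text \<open>
  HOL cannot quantify over all division rings on all types.  The carrier type \<open>'a list\<close> is large
  enough: the division subring generated by the image of \<open>R\<close> is a surjective image of \<open>'a list\<close>.
  The lemma \<open>embeddable_in_division_ringI\<close> below shows that an embedding of \<open>R\<close> into a division
  ring on an arbitrary type is enough for the predicate to hold.
\<close>

definition embeddable_in_division_ring :: "'a ring \<Rightarrow> bool" where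
  "embeddable_in_division_ring R \<longleftrightarrow>
     (\<exists>(D :: 'a list ring) f. skew_field D \<and> f \<in> Ring.ring_hom R D \<and> inj_on f (carrier R))"

datatype 'a divring_term =
    Const 'a
  | Plus "'a divring_term" "'a divring_term"
  | Times "'a divring_term" "'a divring_term"
  | Inverse "'a divring_term"

primrec divring_eval ::
  "('a, 'c) ring_scheme \<Rightarrow> ('b, 'd) ring_scheme \<Rightarrow> ('a \<Rightarrow> 'b) \<Rightarrow> 'a divring_term \<Rightarrow> 'b" where
  "divring_eval R D f (Const x) = (if x \<in> carrier R then f x else \<zero>\<^bsub>D\<^esub>)"
| "divring_eval R D f (Plus s t) = divring_eval R D f s \<oplus>\<^bsub>D\<^esub> divring_eval R D f t"
| "divring_eval R D f (Times s t) = divring_eval R D f s \<otimes>\<^bsub>D\<^esub> divring_eval R D f t"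
| "divring_eval R D f (Inverse s) =
     (let x = divring_eval R D f s in if x = \<zero>\<^bsub>D\<^esub> then \<zero>\<^bsub>D\<^esub> else inv\<^bsub>D\<^esub> x)"

primrec divring_encode :: "'a \<Rightarrow> 'a \<Rightarrow> 'a divring_term \<Rightarrow> 'a list" where
  "divring_encode p q (Const x) = [p, p, x]"
| "divring_encode p q (Plus s t) = [p, q] @ divring_encode p q s @ divring_encode p q t"
| "divring_encode p q (Times s t) = [q, p] @ divring_encode p q s @ divring_encode p q t"
| "divring_encode p q (Inverse s) = [q, q] @ divring_encode p q s"

lemma divring_encode_prefix_free:
  assumes "p \<noteq> q"
  shows "divring_encode p q s @ xs = divring_encode p q t @ ys \<Longrightarrow> s = t \<and> xs = ys"
proof (induction s arbitrary: t xs ys)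
  case (Const x)
  then show ?case using assms by (cases t) auto
next
  case (Plus s1 s2)
  from Plus.prems obtain t1 t2 where t: "t = Plus t1 t2"
    and eq: "divring_encode p q s1 @ (divring_encode p q s2 @ xs) =
             divring_encode p q t1 @ (divring_encode p q t2 @ ys)"
    using assms by (cases t) simp_all
  from Plus.IH(1)[OF eq] have "s1 = t1"
    and "divring_encode p q s2 @ xs = divring_encode p q t2 @ ys" by simp_all
  with Plus.IH(2) t show ?case by simp
next
  case (Times s1 s2)
  from Times.prems obtain t1 t2 where t: "t = Times t1 t2"
    and eq: "divring_encode p q s1 @ (divring_encode p q s2 @ xs) =
             divring_encode p q t1 @ (divring_encode p q t2 @ ys)"
    using assms by (cases t) simp_all
  from Times.IH(1)[OF eq] have "s1 = t1"
    and "divring_encode p q s2 @ xs = divring_encode p q t2 @ ys" by simp_all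
  with Times.IH(2) t show ?case by simp
next
  case (Inverse s)
  from Inverse.prems obtain t' where t: "t = Inverse t'"
    and eq: "divring_encode p q s @ xs = divring_encode p q t' @ ys"
    using assms by (cases t) simp_all
  from Inverse.IH[OF eq] t show ?case by simp
qed

lemma inj_divring_encode: "p \<noteq> q \<Longrightarrow> inj (divring_encode p q)"
  by (rule injI) (metis divring_encode_prefix_free)

lemma skew_field_image_ring:
  assumes "skew_field D" and "inj_on g (carrier D)"
  shows "skew_field (image_ring g D)"
proof -
  interpret D: ring D using assms(1) unfolding skew_field_def by blast
  have U: "Units D = carrier D - {\<zero>\<^bsub>D\<^esub>}" using assms(1) unfolding skew_field_def by blast
  have iso: "g \<in> ring_iso D (image_ring g D)"
    using inj_imp_image_ring_iso[OF assms(2)] .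
  have E: "ring (image_ring g D)" using D.inj_imp_image_ring_is_ring[OF assms(2)] .
  interpret E: ring "image_ring g D" by (rule E)
  have hom: "g x \<otimes>\<^bsub>image_ring g D\<^esub> g y = g (x \<otimes>\<^bsub>D\<^esub> y)"
    if "x \<in> carrier D" "y \<in> carrier D" for x y
    using iso that unfolding ring_iso_def by (auto simp: ring_hom_mult)
  have "Units (image_ring g D) = g ` Units D"
  proof (intro Set.set_eqI iffI)
    fix a assume "a \<in> Units (image_ring g D)"
    then obtain b where ab: "a \<in> g ` carrier D" "b \<in> g ` carrier D"
      "b \<otimes>\<^bsub>image_ring g D\<^esub> a = g \<one>\<^bsub>D\<^esub>" "a \<otimes>\<^bsub>image_ring g D\<^esub> b = g \<one>\<^bsub>D\<^esub>"
      unfolding Units_def by (auto simp: image_ring_carrier image_ring_one)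
    then obtain x y where xy: "x \<in> carrier D" "y \<in> carrier D" "a = g x" "b = g y" by blast
    have "y \<otimes>\<^bsub>D\<^esub> x = \<one>\<^bsub>D\<^esub>" "x \<otimes>\<^bsub>D\<^esub> y = \<one>\<^bsub>D\<^esub>"
      using ab(3,4) xy assms(2) by (simp_all add: hom inj_on_eq_iff)
    then show "a \<in> g ` Units D" using xy unfolding Units_def by blast
  next
    fix a assume "a \<in> g ` Units D"
    then obtain x y where "x \<in> carrier D" "y \<in> carrier D" "a = g x"
      "y \<otimes>\<^bsub>D\<^esub> x = \<one>\<^bsub>D\<^esub>" "x \<otimes>\<^bsub>D\<^esub> y = \<one>\<^bsub>D\<^esub>"
      unfolding Units_def by blast
    then show "a \<in> Units (image_ring g D)"
      unfolding Units_def using hom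
      by (auto simp: image_ring_carrier image_ring_one intro!: bexI[of _ y])
  qed
  also have "\<dots> = g ` carrier D - {g \<zero>\<^bsub>D\<^esub>}"
    using inj_on_image_set_diff[OF assms(2), of "carrier D" "{\<zero>\<^bsub>D\<^esub>}"] by (simp add: U)
  finally show ?thesis
    unfolding skew_field_def using E by (simp add: image_ring_carrier image_ring_zero)
qed

lemma embeddable_in_division_ringI:
  fixes R :: "'a ring" and D :: "'b ring"
  assumes "ring R" and D: "skew_field D" and f: "f \<in> Ring.ring_hom R D" and inj: "inj_on f (carrier R)"
  shows "embeddable_in_division_ring R"
proof -
  interpret R: ring R by fact
  interpret D: ring D using D unfolding skew_field_def by blast
  interpret f: ring_hom_ring R D f by (rule ring_hom_ringI2) (use assms D.ring_axioms in auto)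
  have U: "Units D = carrier D - {\<zero>\<^bsub>D\<^esub>}" using D unfolding skew_field_def by blast
  have D10: "\<one>\<^bsub>D\<^esub> \<noteq> \<zero>\<^bsub>D\<^esub>" using U D.Units_one_closed by auto
  then have R10: "\<zero>\<^bsub>R\<^esub> \<noteq> \<one>\<^bsub>R\<^esub>" using f.hom_zero f.hom_one by metis
  let ?ev = "divring_eval R D f"
  define K where "K = range ?ev"
  have inv_closed: "inv\<^bsub>D\<^esub> x \<in> carrier D" if "x \<in> carrier D" "x \<noteq> \<zero>\<^bsub>D\<^esub>" for x
    using that U by (simp add: D.Units_inv_closed)
  have ev_closed: "?ev t \<in> carrier D" for t
    by (induction t) (auto simp: Let_def inv_closed)
  have K_sub: "K \<subseteq> carrier D" using ev_closed unfolding K_def by blast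
  have K_elem: "f x \<in> K" if "x \<in> carrier R" for x
    using that unfolding K_def by (intro image_eqI[of _ _ "Const x"]) auto
  have K_add: "x \<oplus>\<^bsub>D\<^esub> y \<in> K" if "x \<in> K" "y \<in> K" for x y
  proof -
    from that obtain s t where "x = ?ev s" "y = ?ev t" unfolding K_def by blast
    then show ?thesis unfolding K_def by (intro range_eqI[of _ _ "Plus s t"]) simp
  qed
  have K_mult: "x \<otimes>\<^bsub>D\<^esub> y \<in> K" if "x \<in> K" "y \<in> K" for x y
  proof -
    from that obtain s t where "x = ?ev s" "y = ?ev t" unfolding K_def by blast
    then show ?thesis unfolding K_def by (intro range_eqI[of _ _ "Times s t"]) simp
  qed
  have K_inv: "inv\<^bsub>D\<^esub> x \<in> K" if "x \<in> K" "x \<noteq> \<zero>\<^bsub>D\<^esub>" for x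
  proof -
    from that obtain s where "x = ?ev s" unfolding K_def by blast
    with that show ?thesis unfolding K_def by (intro range_eqI[of _ _ "Inverse s"]) simp
  qed
  have K_one: "\<one>\<^bsub>D\<^esub> \<in> K" using K_elem[of "\<one>\<^bsub>R\<^esub>"] by simp
  have "\<ominus>\<^bsub>D\<^esub> \<one>\<^bsub>D\<^esub> \<in> K" using K_elem[of "\<ominus>\<^bsub>R\<^esub> \<one>\<^bsub>R\<^esub>"] by simp
  then have K_neg: "\<ominus>\<^bsub>D\<^esub> x \<in> K" if "x \<in> K" for x
    using K_mult[of "\<ominus>\<^bsub>D\<^esub> \<one>\<^bsub>D\<^esub>" x] that K_sub by (auto simp: D.l_minus)
  have sub: "subring K D"
    using K_sub K_one K_neg K_mult K_add by (rule D.subringI)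
  let ?K = "D\<lparr>carrier := K\<rparr>"
  have K_skew: "skew_field ?K"
    unfolding skew_field_def
  proof (intro conjI Set.set_eqI iffI)
    show "ring ?K" using D.subring_is_ring[OF sub] .
  next
    fix x assume "x \<in> Units ?K"
    then have "x \<in> K" "x \<in> Units D" using K_sub unfolding Units_def by auto
    then show "x \<in> carrier ?K - {\<zero>\<^bsub>?K\<^esub>}" using U by auto
  next
    fix x assume "x \<in> carrier ?K - {\<zero>\<^bsub>?K\<^esub>}"
    then have x: "x \<in> K" "x \<noteq> \<zero>\<^bsub>D\<^esub>" by auto
    then have "x \<in> Units D" using U K_sub by auto
    then have "inv\<^bsub>D\<^esub> x \<otimes>\<^bsub>D\<^esub> x = \<one>\<^bsub>D\<^esub>" "x \<otimes>\<^bsub>D\<^esub> inv\<^bsub>D\<^esub> x = \<one>\<^bsub>D\<^esub>" by auto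
    then show "x \<in> Units ?K" using x K_inv[OF x] unfolding Units_def by auto
  qed
  define g where "g = divring_encode \<zero>\<^bsub>R\<^esub> \<one>\<^bsub>R\<^esub> \<circ> inv_into UNIV ?ev"
  have g_inj: "inj_on g (carrier ?K)"
    unfolding g_def K_def using inj_divring_encode[OF R10]
    by (auto intro!: comp_inj_on inj_on_inv_into intro: inj_on_subset)
  have fK: "f \<in> Ring.ring_hom R ?K"
    using K_elem unfolding Ring.ring_hom_def by auto
  have "g \<in> Ring.ring_hom ?K (image_ring g ?K)"
    using inj_imp_image_ring_iso[OF g_inj] unfolding ring_iso_def by blast
  then have "g \<circ> f \<in> Ring.ring_hom R (image_ring g ?K)"
    by (rule ring_hom_trans[OF fK])
  moreover have "inj_on (g \<circ> f) (carrier R)"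
    using inj g_inj K_elem by (auto intro!: comp_inj_on intro: inj_on_subset)
  ultimately show ?thesis
    unfolding embeddable_in_division_ring_def
    using skew_field_image_ring[OF K_skew g_inj] by blast
qed

hide_const (open) Const Plus Times Inverse

end

theory Submission
  imports Defs
begin

text \<open>
  The conditions (a), (b), (c) say that exchange holds for all sets \<open>S\<close>, or for sets of at most \<open>n - 1\<close>
  columns.  The restricted form suffices for a Steinitz replacement argument starting from the unit
  vectors, and this reduces the closure of an arbitrary set to that of at most \<open>n\<close> of its elements.

  For the embedding, exchange shows that fewer than \<open>n\<close> columns in \<open>R\<^sup>n\<close> have a nonzero annihilator in
  \<open>M\<^sup>n\<close>.  Adjoin to one generator \<open>e\<close> formal solutions \<open>y\<close> of all systems \<open>y P = w\<close> with \<open>P\<close> square and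
  injective on \<open>M\<^sup>n\<close>, and identify two terms if finitely many of these equations force them to agree
  under every assignment of values in \<open>M\<close>.  Counting equations and unknowns, \<open>e\<close> is not forced to be
  zero.  Every term is of the form \<open>e d\<close>, and substitution for \<open>e\<close> turns the classes of terms into a ring
  of elements \<open>d\<close>.  If a term \<open>t\<close> is not forced to be zero, then by exchange the equations defining it
  together with the value of \<open>t\<close> form an injective square system, whose solution expresses \<open>e\<close> through
  \<open>t\<close>.  This is a right inverse of \<open>t\<close>, so the ring is a division ring.
\<close>

section \<open>Annihilator closures\<close>

lemma closure_opD:
  assumes "closure_operator_on X c"
  shows "S \<subseteq> X \<Longrightarrow> c S \<subseteq> X"
    and "S \<subseteq> T \<Longrightarrow> T \<subseteq> X \<Longrightarrow> c S \<subseteq> c T"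
    and "S \<subseteq> X \<Longrightarrow> S \<subseteq> c S"
    and "S \<subseteq> X \<Longrightarrow> c (c S) = c S"
  using assms by (simp_all add: closure_operator_on_def)

lemma closure_op_subset_iff:
  assumes "closure_operator_on X c" "S \<subseteq> X" "T \<subseteq> X"
  shows "c S \<subseteq> c T \<longleftrightarrow> S \<subseteq> c T"
proof
  show "S \<subseteq> c T" if "c S \<subseteq> c T"
    using closure_opD(3)[OF assms(1,2)] that by (rule order_trans)
  show "c S \<subseteq> c T" if "S \<subseteq> c T"
    using closure_opD(2)[OF assms(1) that closure_opD(1)[OF assms(1,3)]]
    by (simp only: closure_opD(4)[OF assms(1,3)])
qed

context right_module
begin

lemma act_zero_left [simp]: "act 0 r = 0"
  using add_act[of 0 0 r] by simp

lemma act_zero_right [simp]: "act a 0 = 0"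
  using act_add[of a 0 0] by simp

lemma act_minus_left: "act (- a) r = - act a r"
  using add_act[of a "- a" r] by (simp add: eq_neg_iff_add_eq_0 add.commute)

lemma act_minus_right: "act a (- r) = - act a r"
  using act_add[of a r "- r"] by (simp add: eq_neg_iff_add_eq_0 add.commute)

lemma act_diff_left: "act (a - b) r = act a r - act b r"
  using add_act[of a "- b" r] by (simp add: act_minus_left)

lemma act_sum_left: "act (sum f I) r = (\<Sum>i\<in>I. act (f i) r)"
  by (induction I rule: infinite_finite_induct) (auto simp: add_act)

lemma row_col_add:
  assumes "x \<in> carrier_vec n" "y \<in> carrier_vec n"
  shows "row_col act a (x + y) = row_col act a x + row_col act a y"
  using assms by (simp add: row_col_def act_add sum.distrib)

lemma row_col_rscale: "row_col act a (vec_rscale x r) = act (row_col act a x) r"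
  by (simp add: row_col_def vec_rscale_def act_mult act_sum_left)

lemma row_col_zero [simp]: "row_col act a (0\<^sub>v n) = 0"
  by (simp add: row_col_def)

lemma row_col_zero_left [simp]: "x \<in> carrier_vec n \<Longrightarrow> row_col act (0\<^sub>v n) x = 0"
  by (simp add: row_col_def)

lemma row_col_unit [simp]:
  assumes "i < n"
  shows "row_col act a (unit_vec n i) = a $ i"
proof -
  have "row_col act a (unit_vec n i) = (\<Sum>k<n. if k = i then a $ i else 0)"
    unfolding row_col_def dim_vec index_unit_vec by (intro sum.cong) (use assms in \<open>auto simp: act_one\<close>)
  then show ?thesis using assms by simp
qed

lemma vec_rscale_carrier [simp]: "vec_rscale x r \<in> carrier_vec n \<longleftrightarrow> x \<in> carrier_vec n"
  by (auto simp: vec_rscale_def)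

lemma ann_insert: "ann act n (insert x S) = ann act n S \<inter> ann act n {x}"
  by (auto simp: ann_def)

lemma in_cl_iff:
  "x \<in> cl act n S \<longleftrightarrow> x \<in> carrier_vec n \<and> (\<forall>a\<in>ann act n S. row_col act a x = 0)"
  by (auto simp: cl_def ann_def)

lemma closure_operator_on_cl: "closure_operator_on (carrier_vec n) (cl act n)"
proof -
  have "cl act n (cl act n S) \<subseteq> cl act n S" for S
    by (auto simp: in_cl_iff ann_def)
  then show ?thesis
    unfolding closure_operator_on_def by (fastforce simp: in_cl_iff ann_def)
qed

lemma right_submodule_cl: "right_submodule n (cl act n S)"
  by (auto simp: right_submodule_def in_cl_iff row_col_add row_col_rscale)

lemma cl_empty_proper:
  assumes "(w::'m) \<noteq> 0" "n > 0"
  shows "cl act n {} \<noteq> carrier_vec n"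
proof -
  have "vec n (\<lambda>_. w) \<in> ann act n {}"
    by (simp add: ann_def)
  moreover have "row_col act (vec n (\<lambda>_. w)) (unit_vec n 0) \<noteq> 0"
    using assms by simp
  ultimately have "unit_vec n 0 \<notin> cl act n {}"
    by (auto simp: in_cl_iff)
  then show ?thesis by auto
qed

section \<open>Homomorphisms and preimages of closed sets\<close>

lemma row_col_hom:
  assumes h: "right_module_hom m n h" and x: "x \<in> carrier_vec m"
  shows "row_col act a (h x) = row_col act (vec m (\<lambda>i. row_col act a (h (unit_vec m i)))) x"
proof -
  have hc: "h y \<in> carrier_vec n" if "y \<in> carrier_vec m" for y
    using h that by (auto simp: right_module_hom_def)
  have hadd: "h (y + z) = h y + h z" if "y \<in> carrier_vec m" "z \<in> carrier_vec m" for y z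
    using h that by (auto simp: right_module_hom_def)
  have hsc: "h (vec_rscale y r) = vec_rscale (h y) r" if "y \<in> carrier_vec m" for y r
    using h that by (auto simp: right_module_hom_def)
  \<comment> \<open>The value of \<open>a\<close> on \<open>h x\<close> is linear in
    \<open>x\<close>, hence determined by the unit vectors. The truncations \<open>tr k\<close> add
    one coordinate of \<open>x\<close> at a time.\<close>
  define tr where "tr k = vec m (\<lambda>i. if i < k then x $ i else 0)" for k
  have "row_col act a (h (tr k)) = (\<Sum>i<k. act (row_col act a (h (unit_vec m i))) (x $ i))"
    if "k \<le> m" for k
    using that
  proof (induction k)
    case 0
    \<comment> \<open>Preservation of zero is not part of \<open>right_module_hom\<close>; it
      follows from homogeneity with the scalar 0.\<close>
    have "tr 0 = vec_rscale (tr 0) 0"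
      by (auto simp: tr_def vec_rscale_def)
    then have "h (tr 0) = vec_rscale (h (tr 0)) 0"
      using hsc[of "tr 0" 0] by (simp add: tr_def)
    then show ?case
      using row_col_rscale[of a "h (tr 0)" 0] by simp
  next
    case (Suc k)
    have "tr (Suc k) = tr k + vec_rscale (unit_vec m k) (x $ k)"
      using Suc.prems by (intro eq_vecI) (auto simp: tr_def vec_rscale_def less_Suc_eq)
    then have "h (tr (Suc k)) = h (tr k) + vec_rscale (h (unit_vec m k)) (x $ k)"
      using hadd[of "tr k" "vec_rscale (unit_vec m k) (x $ k)"] hsc[of "unit_vec m k"]
      by (simp add: tr_def)
    then show ?case
      using Suc hc[of "tr k"] hc[of "unit_vec m k"]
      by (simp add: row_col_add[of _ n] row_col_rscale tr_def)
  qed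
  from this[of m] have "row_col act a (h (tr m)) = (\<Sum>i<m. act (row_col act a (h (unit_vec m i))) (x $ i))"
    by simp
  moreover have "tr m = x" using x by (auto simp: tr_def)
  ultimately show ?thesis using x by (simp add: row_col_def)
qed

lemma right_submodule_vimage:
  assumes h: "right_module_hom m n h" and A: "right_submodule n A"
  shows "right_submodule m {x \<in> carrier_vec m. h x \<in> A}"
proof -
  have "h (0\<^sub>v m) = h (vec_rscale (0\<^sub>v m) 0)"
    by (rule arg_cong[of _ _ h]) (auto simp: vec_rscale_def)
  also have "\<dots> = vec_rscale (h (0\<^sub>v m)) 0"
    using h by (auto simp: right_module_hom_def)
  also have "\<dots> = 0\<^sub>v n"
  proof -
    have "h (0\<^sub>v m) \<in> carrier_vec n"
      using h by (auto simp: right_module_hom_def)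
    then show ?thesis by (intro eq_vecI) (auto simp: vec_rscale_def)
  qed
  finally show ?thesis
    using assms by (auto simp: right_submodule_def right_module_hom_def)
qed

text \<open>Pulling back along \<open>h\<close> turns every row annihilating \<open>A\<close> into a
  row \<open>b\<close> annihilating the preimage. So \<open>h\<close> sends the closure of the
  preimage into the closure of \<open>A\<close>.\<close>

lemma closed_subset_vimage:
  assumes h: "right_module_hom m n h" and A: "closed_subset (carrier_vec n) (cl act n) A"
  shows "closed_subset (carrier_vec m) (cl act m) {x \<in> carrier_vec m. h x \<in> A}"
proof -
  let ?B = "{x \<in> carrier_vec m. h x \<in> A}"
  have "h x \<in> A" if x: "x \<in> cl act m ?B" for x
  proof -
    have xm: "x \<in> carrier_vec m" using x by (simp add: in_cl_iff)
    have "row_col act a (h x) = 0" if a: "a \<in> ann act n A" for a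
    proof -
      define b where "b = vec m (\<lambda>i. row_col act a (h (unit_vec m i)))"
      have b: "row_col act b y = row_col act a (h y)" if "y \<in> carrier_vec m" for y
        using row_col_hom[OF h that] by (simp add: b_def)
      have "b \<in> carrier_vec m"
        by (simp add: b_def)
      then have "b \<in> ann act m ?B"
        using a b by (auto simp: ann_def)
      then show ?thesis using x b[OF xm] by (auto simp: in_cl_iff)
    qed
    then have "h x \<in> cl act n A"
      using h xm by (auto simp: in_cl_iff right_module_hom_def)
    then show ?thesis using A by (simp add: closed_subset_def)
  qed
  moreover have "?B \<subseteq> cl act m ?B"
    using closure_opD(3)[OF closure_operator_on_cl, of ?B] by blast
  moreover have "cl act m ?B \<subseteq> carrier_vec m"
    by (auto simp: in_cl_iff)
  ultimately show ?thesis
    unfolding closed_subset_def by blast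
qed

section \<open>The exchange property\<close>

text \<open>The first inclusion is proper exactly when \<open>u\<close> lies outside the closure of
  \<open>S\<close>. The second holds exactly when \<open>u\<close> is in the closure of
  \<open>insert t S\<close>, and is then proper exactly when \<open>t\<close> is not in that of
  \<open>insert u S\<close>. Thus a chain is a failure of exchange.\<close>

lemma ann_chain_iff:
  assumes "u \<in> carrier_vec n" "t \<in> carrier_vec n"
  shows "ann act n S \<supset> ann act n (insert u S) \<and> ann act n (insert u S) \<supset> ann act n (insert t S) \<longleftrightarrow>
    u \<notin> cl act n S \<and> u \<in> cl act n (insert t S) \<and> t \<notin> cl act n (insert u S)"
  using assms by (auto simp: in_cl_iff ann_def)

lemma exchange_iff_no_set_chain:
  "exchange_property (carrier_vec n) (cl act n) \<longleftrightarrow> no_set_chain act n"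
proof -
  have "no_set_chain act n \<longleftrightarrow> \<not> (\<exists>S u t. S \<subseteq> carrier_vec n \<and> u \<in> carrier_vec n \<and> t \<in> carrier_vec n \<and>
    u \<notin> cl act n S \<and> u \<in> cl act n (insert t S) \<and> t \<notin> cl act n (insert u S))"
    unfolding no_set_chain_def by (simp add: ann_chain_iff cong: conj_cong)
  then show ?thesis
    unfolding exchange_property_def by auto
qed

end

section \<open>Steinitz replacement for closure operators\<close>

definition indep_list :: "('a set \<Rightarrow> 'a set) \<Rightarrow> 'a list \<Rightarrow> bool" where
  "indep_list c xs \<longleftrightarrow> (\<forall>i<length xs. xs ! i \<notin> c (set (take i xs)))"

lemma indep_list_snoc: "indep_list c (xs @ [x]) \<longleftrightarrow> indep_list c xs \<and> x \<notin> c (set xs)"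
  by (simp add: indep_list_def nth_append All_less_Suc conj_commute cong: conj_cong)

text \<open>Each induction step trades one element of \<open>G\<close> for the new \<open>x\<close>.
  Exchange is only ever invoked over a set with fewer than \<open>card G\<close> elements, so the
  restricted form suffices.\<close>

lemma steinitz_replacement:
  assumes c: "closure_operator_on X c"
    and ex: "\<And>S t u. \<lbrakk>finite S; card S < card G; S \<subseteq> X; t \<in> X; u \<in> X; u \<notin> c S; u \<in> c (insert t S)\<rbrakk>
      \<Longrightarrow> t \<in> c (insert u S)"
    and G: "finite G" "G \<subseteq> X" "c G = X"
    and xs: "indep_list c xs" "set xs \<subseteq> X"
  shows "\<exists>H\<subseteq>G. card H + length xs \<le> card G \<and> c (set xs \<union> H) = X"
  using xs
proof (induction xs rule: rev_induct)
  case Nil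
  show ?case using G(3) by (intro exI[of _ G]) simp
next
  case (snoc x xs)
  then obtain H where H: "H \<subseteq> G" "card H + length xs \<le> card G" "c (set xs \<union> H) = X"
    by (auto simp: indep_list_snoc)
  have xX: "x \<in> X" "set xs \<subseteq> X" and xn: "x \<notin> c (set xs)"
    using snoc.prems by (auto simp: indep_list_snoc)
  have finH: "finite H" and HX: "H \<subseteq> X" using H G finite_subset by auto
  \<comment> \<open>A minimal \<open>K\<close> with \<open>x\<close> in the closure of
    \<open>set xs \<union> K\<close> is nonempty because \<open>x\<close> is independent of
    \<open>xs\<close>; by minimality, any \<open>y\<close> in \<open>K\<close> can be exchanged for
    \<open>x\<close>.\<close>
  define F where "F = {K. K \<subseteq> H \<and> x \<in> c (set xs \<union> K)}"
  have "finite F" "H \<in> F"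
    using finH H xX by (simp_all add: F_def)
  then obtain K where KF: "K \<in> F" and "\<forall>K'\<in>F. K' \<subseteq> K \<longrightarrow> K = K'"
    using finite_has_minimal2[of F H] by blast
  then have Kmin: "K' \<notin> F" if "K' \<subset> K" for K'
    using that by blast
  have K: "K \<subseteq> H" "x \<in> c (set xs \<union> K)"
    using KF by (simp_all add: F_def)
  have "K \<noteq> {}" using K xn by auto
  then obtain y where y: "y \<in> K" by blast
  let ?S = "set xs \<union> (K - {y})"
  have finK: "finite K" using K finH finite_subset by blast
  have "card ?S \<le> length xs + card (K - {y})"
    by (meson add_mono card_Un_le card_length le_trans order_refl)
  also have "\<dots> < length xs + card K"
    using card_Diff1_less[OF finK y] by simp
  also have "\<dots> \<le> length xs + card H"
    using K finH by (simp add: card_mono)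
  finally have card: "card ?S < card G" using H by simp
  have "insert y ?S = set xs \<union> K" using y by blast
  then have "y \<in> c (insert x ?S)"
    using ex[of ?S y x] card K Kmin[of "K - {y}"] xX HX y finK by (auto simp: F_def)
  moreover have "insert x ?S \<subseteq> set (xs @ [x]) \<union> (H - {y})" using K by auto
  moreover have sX: "set (xs @ [x]) \<union> (H - {y}) \<subseteq> X" using xX HX by auto
  ultimately have "y \<in> c (set (xs @ [x]) \<union> (H - {y}))"
    using closure_opD(2)[OF c] by blast
  then have "set xs \<union> H \<subseteq> c (set (xs @ [x]) \<union> (H - {y}))"
    using closure_opD(3)[OF c sX] by auto
  then have "X \<subseteq> c (set (xs @ [x]) \<union> (H - {y}))"
    using closure_op_subset_iff[OF c, of "set xs \<union> H"] sX xX HX H(3) by auto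
  moreover have "card (H - {y}) + length (xs @ [x]) \<le> card G"
  proof -
    have "y \<in> H" using y K by auto
    then have "Suc (card (H - {y})) = card H" using finH by (simp only: card_Suc_Diff1)
    then show ?thesis using H(2) by simp
  qed
  moreover have "H - {y} \<subseteq> G" using H by auto
  ultimately show ?case
    using closure_opD(1)[OF c sX] by (intro exI[of _ "H - {y}"]) auto
qed

text \<open>A longest independent sequence in \<open>S\<close> exists by the replacement bound and
  has the same closure as \<open>S\<close>. If \<open>u\<close> is outside that closure, the
  sequence is shorter than \<open>card G\<close>, and restricted exchange applies to it.\<close>

lemma exchange_property_from_bounded:
  assumes c: "closure_operator_on X c"
    and ex: "\<And>S t u. \<lbrakk>finite S; card S < card G; S \<subseteq> X; t \<in> X; u \<in> X; u \<notin> c S; u \<in> c (insert t S)\<rbrakk>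
      \<Longrightarrow> t \<in> c (insert u S)"
    and G: "finite G" "G \<subseteq> X" "c G = X"
  shows "exchange_property X c"
  unfolding exchange_property_def
proof (intro allI impI, elim conjE)
  fix S t u
  assume S: "S \<subseteq> X" and t: "t \<in> X" and u: "u \<in> X" "u \<notin> c S" "u \<in> c (S \<union> {t})"
  let ?L = "\<lambda>k. \<exists>xs. indep_list c xs \<and> set xs \<subseteq> S \<and> length xs = k"
  have repl: "\<exists>H\<subseteq>G. card H + length xs \<le> card G \<and> c (set xs \<union> H) = X"
    if "indep_list c xs" "set xs \<subseteq> S" for xs
    by (rule steinitz_replacement[OF c _ G that(1)]) (use ex that S in auto)
  have bound: "\<forall>k. ?L k \<longrightarrow> k \<le> card G"
    using repl by fastforce
  have "?L 0" by (intro exI[of _ "[]"]) (simp add: indep_list_def)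
  then obtain k where k: "?L k" "\<forall>k'. ?L k' \<longrightarrow> k' \<le> k"
    using Nat.ex_has_greatest_nat[OF _ bound, of 0] by blast
  then obtain xs where xs: "indep_list c xs" "set xs \<subseteq> S" "length xs = k" by blast
  have "x \<in> c (set xs)" if x: "x \<in> S" for x
  proof (rule ccontr)
    assume "x \<notin> c (set xs)"
    then have "?L (Suc k)"
      using x xs by (intro exI[of _ "xs @ [x]"]) (simp add: indep_list_snoc)
    then show False using k(2) by fastforce
  qed
  then have Sxs: "S \<subseteq> c (set xs)" by blast
  have xsX: "set xs \<subseteq> X" using xs S by blast
  have eq: "c S = c (set xs)"
    using closure_op_subset_iff[OF c S xsX] Sxs closure_opD(2)[OF c xs(2) S] by (intro subset_antisym) simp_all
  from repl[OF xs(1,2)] obtain H where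
    H: "H \<subseteq> G" "card H + length xs \<le> card G" "c (set xs \<union> H) = X" by blast
  \<comment> \<open>If no element of \<open>G\<close> were left over, \<open>xs\<close> would
    already span and its closure would contain \<open>u\<close>.\<close>
  have "card H \<noteq> 0"
  proof
    assume "card H = 0"
    then have "H = {}" using H G finite_subset by fastforce
    then show False using H u eq by auto
  qed
  then have "card (set xs) < card G"
    using H(2) card_length[of xs] by linarith
  moreover have "u \<in> c (insert t (set xs))"
  proof -
    have iX: "insert t (set xs) \<subseteq> X" using t xsX by auto
    have "S \<union> {t} \<subseteq> c (insert t (set xs))"
      using Sxs closure_opD(2)[OF c subset_insertI iX] closure_opD(3)[OF c iX] by blast
    then have "c (S \<union> {t}) \<subseteq> c (insert t (set xs))"
      using closure_op_subset_iff[OF c _ iX, of "S \<union> {t}"] S t by simp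
    then show ?thesis using u(3) by blast
  qed
  ultimately have "t \<in> c (insert u (set xs))"
    using ex[of "set xs" t u] xsX t u(1,2) eq by simp
  moreover have "insert u (set xs) \<subseteq> S \<union> {u}" "S \<union> {u} \<subseteq> X"
    using xs(2) S u(1) by auto
  ultimately show "t \<in> c (S \<union> {u})"
    using closure_opD(2)[OF c] by blast
qed

section \<open>Matrix forms of the exchange condition\<close>

context right_module
begin

lemma ann_unit_vecs: "ann act n (unit_vec n ` {..<n}) \<subseteq> {0\<^sub>v n}"
  by (auto simp: ann_def intro!: eq_vecI)

lemma cl_eq_carrier:
  assumes "ann act n S \<subseteq> {0\<^sub>v n}"
  shows "cl act n S = carrier_vec n"
  using assms by (fastforce simp: in_cl_iff)

lemma cl_unit_vecs: "cl act n (unit_vec n ` {..<n}) = carrier_vec n"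
  by (rule cl_eq_carrier[OF ann_unit_vecs])

lemma card_unit_vecs_le: "card (unit_vec n ` {..<n} :: 'r vec set) \<le> n"
  using card_image_le[of "{..<n}" "unit_vec n :: nat \<Rightarrow> 'r vec"] by simp

lemma ann_mat_eq_ann_cols:
  assumes "A \<in> carrier_mat n m"
  shows "ann_mat act A = ann act n (set (cols A))"
  using assms by (auto simp: ann_mat_def ann_def row_mat_def cols_def vec_eq_iff)

lemma adds_column_set:
  assumes "adds_column A B"
  obtains v where "set (cols B) = insert v (set (cols A))"
proof -
  obtain xs v ys where "cols A = xs @ ys" "cols B = xs @ [v] @ ys"
    using assms unfolding adds_column_def by blast
  then have "set (cols B) = insert v (set (cols A))" by simp
  then show thesis by (rule that)
qed

lemma no_added_column_chain_if_no_set_chain: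
  assumes "no_set_chain act n"
  shows "no_added_column_chain act n"
  unfolding no_added_column_chain_def
proof (intro impI notI, elim exE conjE)
  fix A B C
  assume A: "A \<in> carrier_mat n (n - 1)" and B: "B \<in> carrier_mat n n" and C: "C \<in> carrier_mat n n"
    and add: "adds_column A B" "adds_column A C"
    and chain: "ann_mat act B \<subset> ann_mat act A" "ann_mat act C \<subset> ann_mat act B"
  obtain u where u: "set (cols B) = insert u (set (cols A))" using adds_column_set[OF add(1)] .
  obtain t where t: "set (cols C) = insert t (set (cols A))" using adds_column_set[OF add(2)] .
  have "set (cols A) \<subseteq> carrier_vec n" "set (cols B) \<subseteq> carrier_vec n" "set (cols C) \<subseteq> carrier_vec n"
    using A B C cols_dim by blast+
  then show False
    using assms chain u t unfolding no_set_chain_def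
    by (simp add: ann_mat_eq_ann_cols[OF A] ann_mat_eq_ann_cols[OF B] ann_mat_eq_ann_cols[OF C])
qed

lemma no_changed_column_chain_if_no_set_chain:
  assumes "no_set_chain act n"
  shows "no_changed_column_chain act n"
  unfolding no_changed_column_chain_def
proof (intro notI, elim exE conjE)
  fix A B C j
  assume A: "A \<in> carrier_mat n n" and B: "B \<in> carrier_mat n n" and C: "C \<in> carrier_mat n n"
    and j: "j < n" and same: "\<forall>k<n. k \<noteq> j \<longrightarrow> col A k = col B k \<and> col B k = col C k"
    and chain: "ann_mat act B \<subset> ann_mat act A" "ann_mat act C \<subset> ann_mat act B"
  define S where "S = col A ` ({..<n} - {j})"
  have cols: "set (cols D) = S \<union> {col D j}"
    if "D \<in> carrier_mat n n" "\<forall>k<n. k \<noteq> j \<longrightarrow> col A k = col D k" for D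
  proof -
    have "{..<n} = insert j ({..<n} - {j})" using j by auto
    then have "set (cols D) = insert (col D j) (col D ` ({..<n} - {j}))"
      using that(1) by (metis atLeast_upt carrier_matD(2) cols_def image_insert set_map)
    moreover have "col D ` ({..<n} - {j}) = S"
      using that(2) unfolding S_def by (intro image_cong) auto
    ultimately show ?thesis by simp
  qed
  have eqs: "ann_mat act A = ann act n (S \<union> {col A j})" "ann_mat act B = ann act n (S \<union> {col B j})"
    "ann_mat act C = ann act n (S \<union> {col C j})"
    using cols A B C same by (simp_all add: ann_mat_eq_ann_cols)
  \<comment> \<open>Dropping the varying column of \<open>A\<close> only enlarges the annihilator,
    so the first inclusion stays proper.\<close>
  have "ann act n (S \<union> {col A j}) \<subseteq> ann act n S" by (auto simp: ann_def)
  then have "ann act n S \<supset> ann act n (S \<union> {col B j})"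
    "ann act n (S \<union> {col B j}) \<supset> ann act n (S \<union> {col C j})"
    using chain unfolding eqs by auto
  moreover have "S \<subseteq> carrier_vec n" "col B j \<in> carrier_vec n" "col C j \<in> carrier_vec n"
    using A B C by (auto simp: S_def)
  ultimately show False
    using assms unfolding no_set_chain_def by blast
qed

text \<open>Zero columns do not affect annihilators, so they can pad \<open>S\<close> to the
  \<open>n - 1\<close> columns that the matrix conditions call for.\<close>

lemma ann_columns_list:
  assumes "finite S" "card S < n" "S \<subseteq> carrier_vec n"
  obtains cs where "length cs = n - 1" "set cs \<subseteq> carrier_vec n" "ann act n (set cs) = ann act n S"
proof -
  obtain ss where ss: "set ss = S" "length ss = card S"
    using finite_distinct_list[OF assms(1)] distinct_card by metis
  let ?cs = "ss @ replicate (n - 1 - card S) (0\<^sub>v n)"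
  show thesis
  proof (rule that)
    show "length ?cs = n - 1" using ss assms(2) by simp
    show "set ?cs \<subseteq> carrier_vec n" using ss assms(3) by auto
    show "ann act n (set ?cs) = ann act n S" using ss by (auto simp: ann_def)
  qed
qed

lemma ann_mat_of_cols:
  assumes "set cs \<subseteq> carrier_vec n"
  shows "ann_mat act (mat_of_cols n cs) = ann act n (set cs)"
  using ann_mat_eq_ann_cols[OF mat_of_cols_carrier(1)] assms by simp

lemma ann_insert_cong: "ann act n S = ann act n T \<Longrightarrow> ann act n (insert x S) = ann act n (insert x T)"
  using ann_insert by metis

text \<open>A failure of exchange over \<open>S\<close> is realised by square matrices that share
  the first \<open>n - 1\<close> columns \<open>cs\<close> and end in \<open>u\<close> or
  \<open>t\<close>; such matrices violate either condition.\<close>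

lemma bounded_exchange:
  assumes "no_added_column_chain act n \<or> no_changed_column_chain act n"
    and S: "finite S" "card S < n" "S \<subseteq> carrier_vec n"
    and tu: "t \<in> carrier_vec n" "u \<in> carrier_vec n" "u \<notin> cl act n S" "u \<in> cl act n (insert t S)"
  shows "t \<in> cl act n (insert u S)"
proof (rule ccontr)
  assume "t \<notin> cl act n (insert u S)"
  with tu have chain: "ann act n (insert u S) \<subset> ann act n S" "ann act n (insert t S) \<subset> ann act n (insert u S)"
    using ann_chain_iff[OF tu(2,1), of S] by blast+
  obtain cs where cs: "length cs = n - 1" "set cs \<subseteq> carrier_vec n" "ann act n (set cs) = ann act n S"
    using ann_columns_list[OF S] .
  have n: "n > 0" using S(2) by simp
  define D where "D x = mat_of_cols n (cs @ [x])" for x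
  have D: "D x \<in> carrier_mat n n" for x
    using cs(1) n by (simp add: D_def mat_of_cols_def)
  have annD: "ann_mat act (D x) = ann act n (insert x S)" if "x \<in> carrier_vec n" for x
    using ann_mat_of_cols[of "cs @ [x]" n] cs(2) that ann_insert_cong[OF cs(3)] by (simp add: D_def)
  from assms(1) show False
  proof
    assume "no_added_column_chain act n"
    moreover have "mat_of_cols n cs \<in> carrier_mat n (n - 1)"
      using cs(1) by (simp add: mat_of_cols_def)
    moreover have "adds_column (mat_of_cols n cs) (D x)" if "x \<in> carrier_vec n" for x
    proof -
      have "cols (mat_of_cols n cs) = cs @ []" "cols (D x) = cs @ [x] @ []"
        using cs(2) that by (simp_all add: D_def)
      then show ?thesis
        unfolding adds_column_def D_def by (intro conjI exI) simp_all
    qed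
    ultimately show False
      using D chain cs(3) tu n unfolding no_added_column_chain_def
      by (metis annD ann_mat_of_cols[OF cs(2)])
  next
    assume nc: "no_changed_column_chain act n"
    \<comment> \<open>A zero last column imposes no condition, so \<open>D (0\<^sub>v n)\<close>
      provides the largest annihilator of the chain.\<close>
    have "ann act n (insert (0\<^sub>v n) S) = ann act n S"
      by (auto simp: ann_def)
    then have "ann_mat act (D (0\<^sub>v n)) \<supset> ann_mat act (D u)" "ann_mat act (D u) \<supset> ann_mat act (D t)"
      using chain annD tu by simp_all
    moreover have "col (D x) k = cs ! k" if "x \<in> carrier_vec n" "k < n" "k \<noteq> n - 1" for x k
    proof -
      have "k < length cs" using that(2,3) cs(1) by simp
      then have "cs ! k \<in> carrier_vec n" using cs(2) nth_mem by blast
      with \<open>k < length cs\<close> show ?thesis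
        unfolding D_def by (subst col_mat_of_cols) (simp_all add: nth_append)
    qed
    then have "\<exists>j<n. \<forall>k<n. k \<noteq> j \<longrightarrow> col (D (0\<^sub>v n)) k = col (D u) k \<and> col (D u) k = col (D t) k"
      using n tu by (intro exI[of _ "n - 1"]) simp
    ultimately show False
      using nc D unfolding no_changed_column_chain_def by blast
  qed
qed

text \<open>
  The unit vectors span, so exchange over sets of fewer than \<open>n\<close> columns already bounds the length of
  independent sequences by \<open>n\<close>, and every set has the closure of such a sequence.
\<close>

lemma exchange_if_no_matrix_chain:
  assumes "no_added_column_chain act n \<or> no_changed_column_chain act n"
  shows "exchange_property (carrier_vec n) (cl act n)"
proof (rule exchange_property_from_bounded[OF closure_operator_on_cl])
  show "t \<in> cl act n (insert u S)"
    if "finite S" "card S < card (unit_vec n ` {..<n} :: 'r vec set)" "S \<subseteq> carrier_vec n"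
      "t \<in> carrier_vec n" "u \<in> carrier_vec n" "u \<notin> cl act n S" "u \<in> cl act n (insert t S)" for S t u
    using bounded_exchange[OF assms] that card_unit_vecs_le[of n] by simp
qed (auto simp: cl_unit_vecs)

lemma exchange_iff_no_added_column_chain:
  "exchange_property (carrier_vec n) (cl act n) \<longleftrightarrow> no_added_column_chain act n"
  using exchange_if_no_matrix_chain no_added_column_chain_if_no_set_chain exchange_iff_no_set_chain by blast

lemma exchange_iff_no_changed_column_chain:
  "exchange_property (carrier_vec n) (cl act n) \<longleftrightarrow> no_changed_column_chain act n"
  using exchange_if_no_matrix_chain no_changed_column_chain_if_no_set_chain exchange_iff_no_set_chain by blast

end

section \<open>Systems of linear equations\<close>

locale exchange_module = right_module act
  for act :: "'m::ab_group_add \<Rightarrow> 'r::ring_1 \<Rightarrow> 'm" +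
  assumes nontrivial: "\<exists>w::'m. w \<noteq> 0"
    and exchange: "exchange_property (carrier_vec n) (cl act n)"
begin

text \<open>With trivial annihilator, \<open>G\<close> would span. The unit vectors are independent
  because \<open>M\<close> is nonzero, so replacement would give
  \<open>n \<le> card G\<close>.\<close>

lemma fewer_columns_ann_nonzero:
  assumes G: "finite G" "G \<subseteq> carrier_vec n" "card G < n"
  shows "\<exists>a\<in>ann act n G. a \<noteq> 0\<^sub>v n"
proof (rule ccontr)
  assume "\<not> ?thesis"
  then have span: "cl act n G = carrier_vec n"
    by (intro cl_eq_carrier) blast
  obtain w :: 'm where w: "w \<noteq> 0" using nontrivial by blast
  let ?us = "map (unit_vec n) [0..<n] :: 'r vec list"
  have ind: "indep_list (cl act n) ?us"
    unfolding indep_list_def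
  proof (intro allI impI)
    fix i assume "i < length ?us"
    then have i: "i < n" by simp
    define a where "a = vec n (\<lambda>k. if k = i then w else 0)"
    have "a \<in> ann act n (set (take i ?us))"
      using i by (auto simp: ann_def a_def take_map)
    moreover have "row_col act a (?us ! i) \<noteq> 0"
      using i w by (simp add: a_def)
    ultimately show "?us ! i \<notin> cl act n (set (take i ?us))"
      by (auto simp: in_cl_iff)
  qed
  have ex: "t \<in> cl act n (insert u S)"
    if "S \<subseteq> carrier_vec n" "t \<in> carrier_vec n" "u \<in> carrier_vec n" "u \<notin> cl act n S" "u \<in> cl act n (insert t S)"
    for S t u
    using exchange[of n] that unfolding exchange_property_def by simp
  have "\<exists>H\<subseteq>G. card H + length ?us \<le> card G \<and> cl act n (set ?us \<union> H) = carrier_vec n"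
    by (rule steinitz_replacement[OF closure_operator_on_cl _ G(1,2) span ind]) (use ex in auto)
  then have "length ?us \<le> card G" by (meson add_leE)
  then show False using G(3) by simp
qed

text \<open>The unknowns are indexed by a set of arbitrary type, so that terms can later serve as
  unknowns without being numbered.\<close>

definition lin_form :: "'i set \<Rightarrow> ('i \<Rightarrow> 'r) \<Rightarrow> ('i \<Rightarrow> 'm) \<Rightarrow> 'm" where
  "lin_form F k \<phi> = (\<Sum>v\<in>F. act (\<phi> v) (k v))"

lemma row_col_lin_form:
  assumes "bij_betw f {..<n} F"
  shows "row_col act (vec n (\<lambda>i. \<phi> (f i))) (vec n (\<lambda>i. k (f i))) = lin_form F k \<phi>"
proof -
  have "row_col act (vec n (\<lambda>i. \<phi> (f i))) (vec n (\<lambda>i. k (f i))) = (\<Sum>i<n. act (\<phi> (f i)) (k (f i)))"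
    by (simp add: row_col_def)
  then show ?thesis
    unfolding lin_form_def using sum.reindex_bij_betw[OF assms, of "\<lambda>v. act (\<phi> v) (k v)"] by simp
qed

lemma ann_lin_form_iff:
  assumes "bij_betw f {..<n} F"
  shows "vec n (\<lambda>i. \<phi> (f i)) \<in> ann act n ((\<lambda>k. vec n (\<lambda>i. k (f i))) ` K) \<longleftrightarrow> (\<forall>k\<in>K. lin_form F k \<phi> = 0)"
  by (simp add: ann_def row_col_lin_form[OF assms])

lemma vec_eq_assignment:
  assumes "bij_betw f {..<n} F" "a \<in> carrier_vec n"
  shows "\<exists>\<phi>. a = vec n (\<lambda>i. \<phi> (f i))"
  using assms by (intro exI[of _ "\<lambda>v. a $ inv_into {..<n} f v"]) (auto simp: bij_betw_def intro!: eq_vecI)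

lemma fewer_equations_solution:
  assumes F: "finite F" and K: "finite K" "card K < card F"
  shows "\<exists>\<phi>. (\<forall>k\<in>K. lin_form F k \<phi> = 0) \<and> (\<exists>v\<in>F. \<phi> v \<noteq> 0)"
proof -
  let ?n = "card F"
  obtain f where f: "bij_betw f {..<?n} F"
    using ex_bij_betw_nat_finite[OF F] by (auto simp: atLeast0LessThan)
  let ?G = "(\<lambda>k. vec ?n (\<lambda>i. k (f i))) ` K"
  have "card ?G < ?n"
    using card_image_le[OF K(1)] K(2) by (rule le_less_trans)
  then obtain a where a: "a \<in> ann act ?n ?G" "a \<noteq> 0\<^sub>v ?n"
    using fewer_columns_ann_nonzero[of ?G ?n] K(1) by (auto simp: image_subset_iff)
  then have "a \<in> carrier_vec ?n" by (simp add: ann_def)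
  then obtain \<phi> where eq: "a = vec ?n (\<lambda>i. \<phi> (f i))"
    using vec_eq_assignment[OF f] by blast
  have "\<forall>k\<in>K. lin_form F k \<phi> = 0"
    using a(1) ann_lin_form_iff[OF f, of \<phi> K] eq by simp
  moreover have "\<exists>v\<in>F. \<phi> v \<noteq> 0"
  proof (rule ccontr)
    assume "\<not> ?thesis"
    then have "a = 0\<^sub>v ?n"
      using bij_betwE[OF f] by (subst eq) (auto intro!: eq_vecI)
    then show False using a(2) by simp
  qed
  ultimately show ?thesis by blast
qed

text \<open>This is exchange for consequences of linear equations: \<open>\<psi>\<close> shows that
  \<open>K\<close> does not force \<open>u\<close> to vanish, while \<open>K\<close> with
  \<open>t\<close> does; hence \<open>K\<close> with \<open>u\<close> forces \<open>t\<close> to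
  vanish.\<close>

lemma equations_exchange:
  assumes F: "finite F"
    and psi: "\<forall>k\<in>K. lin_form F k \<psi> = 0" "lin_form F u \<psi> \<noteq> 0"
    and t: "\<And>\<phi>. \<lbrakk>\<forall>k\<in>K. lin_form F k \<phi> = 0; lin_form F t \<phi> = 0\<rbrakk> \<Longrightarrow> lin_form F u \<phi> = 0"
    and phi: "\<forall>k\<in>K. lin_form F k \<phi> = 0" "lin_form F u \<phi> = 0"
  shows "lin_form F t \<phi> = 0"
proof -
  let ?n = "card F"
  obtain f where f: "bij_betw f {..<?n} F"
    using ex_bij_betw_nat_finite[OF F] by (auto simp: atLeast0LessThan)
  define col where "col k = vec ?n (\<lambda>i. k (f i))" for k :: "_ \<Rightarrow> 'r"
  define row where "row \<phi> = vec ?n (\<lambda>i. \<phi> (f i))" for \<phi> :: "_ \<Rightarrow> 'm"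
  have cn: "col k \<in> carrier_vec ?n" for k by (simp add: col_def)
  have rc: "row_col act (row \<phi>) (col k) = lin_form F k \<phi>" for \<phi> k
    unfolding row_def col_def by (rule row_col_lin_form[OF f])
  have ann_row: "row \<phi> \<in> ann act ?n (col ` L) \<longleftrightarrow> (\<forall>k\<in>L. lin_form F k \<phi> = 0)" for \<phi> L
    unfolding row_def col_def by (rule ann_lin_form_iff[OF f])
  have rowE: "\<exists>\<phi>. a = row \<phi>" if "a \<in> ann act ?n L" for a L
    using vec_eq_assignment[OF f, of a] that unfolding row_def ann_def by blast
  have "col u \<notin> cl act ?n (col ` K)"
    using psi ann_row[of \<psi> K] rc[of \<psi> u] unfolding in_cl_iff by metis
  moreover have "col u \<in> cl act ?n (col ` K \<union> {col t})"
    unfolding in_cl_iff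
  proof (intro conjI ballI cn)
    fix a assume a: "a \<in> ann act ?n (col ` K \<union> {col t})"
    then obtain \<phi> where \<phi>: "a = row \<phi>" using rowE by blast
    have "row \<phi> \<in> ann act ?n (col ` insert t K)" using a \<phi> by simp
    then show "row_col act a (col u) = 0"
      using t[of \<phi>] unfolding ann_row \<phi> rc by simp
  qed
  ultimately have "col t \<in> cl act ?n (col ` K \<union> {col u})"
    using exchange[of ?n] cn unfolding exchange_property_def by blast
  moreover have "row \<phi> \<in> ann act ?n (col ` insert u K)"
    unfolding ann_row using phi by simp
  ultimately show ?thesis
    using rc[of \<phi> t] unfolding in_cl_iff by simp
qed

end

section \<open>Formal solutions\<close>

text \<open>
  \<open>Sol n P Q ws i\<close> stands for the entry \<open>y\<^sub>i\<close> of the row \<open>y\<close> of length \<open>n\<close> with \<open>y P = ws Q\<close>, where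
  \<open>P\<close> is an \<open>n \<times> n\<close> matrix acting injectively on \<open>M\<^sup>n\<close>.  If \<open>P\<close> is not of this kind or \<open>i \<ge> n\<close>, the
  term stands for \<open>0\<close>.
\<close>

datatype 'r sol_term = Gen | Sol nat "nat \<Rightarrow> nat \<Rightarrow> 'r" "nat \<Rightarrow> nat \<Rightarrow> 'r" "'r sol_term list" nat

primrec subst :: "'r sol_term \<Rightarrow> 'r sol_term \<Rightarrow> 'r sol_term" where
  "subst t Gen = t"
| "subst t (Sol n P Q ws i) = Sol n P Q (map (subst t) ws) i"

lemma subst_Gen [simp]: "subst s Gen = s" "subst Gen t = t"
  by (simp, induction t) (auto simp: map_idI)

lemma subst_subst: "subst (subst r s) t = subst r (subst s t)"
  by (induction t) auto

text \<open>All entries of a solution row are included, since its equations couple them. The extra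
  index \<open>i\<close> keeps a term in its own support even if \<open>i \<ge> n\<close>.\<close>

primrec support :: "'r sol_term \<Rightarrow> 'r sol_term set" where
  "support Gen = {Gen}"
| "support (Sol n P Q ws i) =
     insert Gen (Sol n P Q ws ` insert i {..<n} \<union> \<Union> (set (map support ws)))"

lemma finite_support: "finite (support t)"
  by (induction t) auto

lemma in_support: "t \<in> support t"
  by (cases t) auto

context exchange_module
begin

section \<open>Defining equations and finite closed systems\<close>

definition nonsing :: "nat \<Rightarrow> (nat \<Rightarrow> nat \<Rightarrow> 'r) \<Rightarrow> bool" where
  "nonsing n P \<longleftrightarrow>
     (\<forall>a. (\<forall>j<n. (\<Sum>i<n. act (a i) (P i j)) = 0) \<longrightarrow> (\<forall>i<n. a i = 0))"

lemma nonsing_unique: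
  assumes "nonsing n P" "\<And>j. j < n \<Longrightarrow> (\<Sum>i<n. act (a i) (P i j)) = (\<Sum>i<n. act (b i) (P i j))" "i < n"
  shows "a i = b i"
proof -
  have "\<forall>j<n. (\<Sum>i<n. act (a i - b i) (P i j)) = 0"
    using assms(2) by (simp add: act_diff_left sum_subtractf)
  then have "a i - b i = 0"
    using assms(1,3) unfolding nonsing_def by (elim allE[of _ "\<lambda>i. a i - b i"]) blast
  then show ?thesis by simp
qed

text \<open>The entry with index \<open>i\<close> carries column \<open>i\<close> of
  \<open>y P = ws Q\<close>, so a row of \<open>n\<close> unknowns brings \<open>n\<close>
  equations. \<open>Gen\<close> carries none and remains free.\<close>

fun residual :: "('r sol_term \<Rightarrow> 'm) \<Rightarrow> 'r sol_term \<Rightarrow> 'm" where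
  "residual \<phi> Gen = 0"
| "residual \<phi> (Sol n P Q ws i) =
    (if i < n \<and> nonsing n P
     then (\<Sum>k<n. act (\<phi> (Sol n P Q ws k)) (P k i)) - (\<Sum>l<length ws. act (\<phi> (ws ! l)) (Q l i))
     else \<phi> (Sol n P Q ws i))"

primrec deps :: "'r sol_term \<Rightarrow> 'r sol_term set" where
  "deps Gen = {}"
| "deps (Sol n P Q ws i) = set ws \<union> Sol n P Q ws ` {..<n}"

text \<open>The equations of a closed set involve only unknowns from that set, so it carries a
  self-contained linear system.\<close>

definition closed_terms :: "'r sol_term set \<Rightarrow> bool" where
  "closed_terms F \<longleftrightarrow> Gen \<in> F \<and> (\<forall>t\<in>F. deps t \<subseteq> F)"

lemma closed_termsD:
  assumes "closed_terms F" "Sol n P Q ws i \<in> F"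
  shows "l < length ws \<Longrightarrow> ws ! l \<in> F" and "k < n \<Longrightarrow> Sol n P Q ws k \<in> F"
proof -
  have "deps (Sol n P Q ws i) \<subseteq> F"
    using assms unfolding closed_terms_def by blast
  then show "l < length ws \<Longrightarrow> ws ! l \<in> F" and "k < n \<Longrightarrow> Sol n P Q ws k \<in> F"
    by auto
qed

lemma closed_terms_support: "closed_terms (support t)"
proof (induction t)
  case Gen
  then show ?case by (simp add: closed_terms_def)
next
  case (Sol n P Q ws i)
  let ?T = "support (Sol n P Q ws i)"
  have sub: "support w \<subseteq> ?T" if "w \<in> set ws" for w using that by auto
  have self: "deps (Sol n P Q ws k) \<subseteq> ?T" for k
    using sub in_support by auto
  have "deps t \<subseteq> ?T" if "t \<in> ?T" for t
  proof -
    from that consider "t = Gen" | k where "t = Sol n P Q ws k" | w where "w \<in> set ws" "t \<in> support w"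
      by auto
    then show ?thesis
    proof cases
      case 3
      then have "deps t \<subseteq> support w"
        using Sol.IH unfolding closed_terms_def by blast
      then show ?thesis using sub[OF 3(1)] by (rule order_trans)
    qed (use self in simp_all)
  qed
  then show ?case by (simp add: closed_terms_def)
qed

lemma closed_terms_UN:
  assumes "I \<noteq> {}" "\<And>i. i \<in> I \<Longrightarrow> closed_terms (F i)"
  shows "closed_terms (\<Union>i\<in>I. F i)"
  unfolding closed_terms_def
proof (intro conjI ballI)
  show "Gen \<in> (\<Union>i\<in>I. F i)"
    using assms by (auto simp: closed_terms_def)
  fix t assume "t \<in> (\<Union>i\<in>I. F i)"
  then obtain i where i: "i \<in> I" "t \<in> F i" by blast
  then have "deps t \<subseteq> F i"
    using assms(2) by (simp add: closed_terms_def)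
  with i(1) show "deps t \<subseteq> (\<Union>i\<in>I. F i)" by (rule UN_upper[THEN order_trans[rotated]])
qed

text \<open>Once the arguments vanish, the solution row satisfies \<open>y P = 0\<close>, and
  \<open>nonsing\<close> gives \<open>y = 0\<close>. By linearity, a solution is determined by its
  value at \<open>Gen\<close>.\<close>

lemma residual_unique:
  assumes F: "closed_terms F"
    and sol: "\<forall>t\<in>F. residual \<phi> t = 0" "\<phi> Gen = 0"
  shows "t \<in> F \<Longrightarrow> \<phi> t = 0"
proof (induction t)
  case Gen
  then show ?case using sol by simp
next
  case (Sol n P Q ws i)
  have ws: "\<phi> (ws ! l) = 0" if "l < length ws" for l
    using Sol.IH[OF nth_mem[OF that]] closed_termsD(1)[OF F Sol.prems that] .
  have mem: "Sol n P Q ws k \<in> F" if "k < n" for k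
    using closed_termsD(2)[OF F Sol.prems that] .
  show ?case
  proof (cases "i < n \<and> nonsing n P")
    case True
    have "\<forall>j<n. (\<Sum>k<n. act (\<phi> (Sol n P Q ws k)) (P k j)) = 0"
      using sol(1) mem ws True by fastforce
    then show ?thesis
      using True unfolding nonsing_def by (elim conjE allE[of _ "\<lambda>k. \<phi> (Sol n P Q ws k)"]) blast
  next
    case False
    then show ?thesis using sol(1) Sol.prems by auto
  qed
qed

lemma lin_form_single:
  assumes "finite F" "v \<in> F"
  shows "act (\<phi> v) r = lin_form F (\<lambda>u. if u = v then r else 0) \<phi>"
proof -
  have "lin_form F (\<lambda>u. if u = v then r else 0) \<phi> = (\<Sum>u\<in>F. if u = v then act (\<phi> v) r else 0)"
    unfolding lin_form_def by (intro sum.cong) auto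
  then show ?thesis using assms by simp
qed

lemma lin_form_sum: "lin_form F (\<lambda>u. \<Sum>i\<in>I. k i u) \<phi> = (\<Sum>i\<in>I. lin_form F (k i) \<phi>)"
proof (induction I rule: infinite_finite_induct)
  case (insert i I)
  then show ?case by (simp add: lin_form_def act_add sum.distrib)
qed (simp_all add: lin_form_def)

lemma lin_form_diff: "lin_form F (\<lambda>u. k u - l u) \<phi> = lin_form F k \<phi> - lin_form F l \<phi>"
  using act_add[of _ "k _" "- l _"] by (simp add: lin_form_def act_minus_right sum_subtractf)

lemma residual_lin_form:
  assumes F: "finite F" "closed_terms F" "t \<in> F"
  shows "\<exists>k. \<forall>\<phi>. residual \<phi> t = lin_form F k \<phi>"
proof (cases t)
  case Gen
  then show ?thesis by (intro exI[of _ "\<lambda>_. 0"]) (simp add: lin_form_def)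
next
  case (Sol n P Q ws i)
  have "Sol n P Q ws i \<in> F" using Sol F(3) by simp
  note ws = closed_termsD(1)[OF F(2) this] and mem = closed_termsD(2)[OF F(2) this]
  show ?thesis
  proof (cases "i < n \<and> nonsing n P")
    case True
    \<comment> \<open>A term may occur several times in \<open>ws\<close>, so its coefficient is a
      sum over all its positions.\<close>
    have "residual \<phi> t = lin_form F (\<lambda>u. (\<Sum>k<n. if u = Sol n P Q ws k then P k i else 0)
        - (\<Sum>l<length ws. if u = ws ! l then Q l i else 0)) \<phi>" for \<phi>
      using True Sol ws mem F(1) by (simp add: lin_form_diff lin_form_sum lin_form_single)
    then show ?thesis by blast
  next
    case False
    then have "residual \<phi> t = lin_form F (\<lambda>u. if u = t then 1 else 0) \<phi>" for \<phi>
      using Sol F lin_form_single[of F t \<phi> 1] by (auto simp: act_one)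
    then show ?thesis by blast
  qed
qed

lemma finite_equations:
  assumes "finite F" "closed_terms F"
  obtains k where "\<And>t \<phi>. t \<in> F \<Longrightarrow> residual \<phi> t = lin_form F (k t) \<phi>"
  using residual_lin_form[OF assms] by metis

text \<open>
  On a closed set \<open>F\<close> there is one equation for each term other than \<open>Gen\<close>, hence fewer equations than
  unknowns; and a solution vanishing at \<open>Gen\<close> vanishes on \<open>F\<close>.
\<close>

lemma solution_Gen_nonzero:
  assumes F: "finite F" "closed_terms F"
  shows "\<exists>\<phi>. (\<forall>t\<in>F. residual \<phi> t = 0) \<and> \<phi> Gen \<noteq> 0"
proof -
  obtain k where k: "\<And>t \<phi>. t \<in> F \<Longrightarrow> residual \<phi> t = lin_form F (k t) \<phi>"
    using finite_equations[OF F] by blast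
  have Gen: "Gen \<in> F" using F(2) by (simp add: closed_terms_def)
  have "card (k ` (F - {Gen})) \<le> card (F - {Gen})"
    using F(1) by (intro card_image_le) simp
  also have "\<dots> < card F"
    using Gen F(1) by (rule card_Diff1_less[rotated])
  finally obtain \<phi> v where \<phi>: "\<forall>l\<in>k ` (F - {Gen}). lin_form F l \<phi> = 0" "v \<in> F" "\<phi> v \<noteq> 0"
    using fewer_equations_solution[of F "k ` (F - {Gen})"] F(1) by auto
  have "residual \<phi> t = 0" if "t \<in> F" for t
    using \<phi>(1) k[OF that] that by (cases "t = Gen") auto
  then show ?thesis
    using residual_unique[OF F(2), of \<phi> v] \<phi>(2,3) by blast
qed

text \<open>On \<open>F\<close>, the condition \<open>Gen = 0\<close> forces \<open>t = 0\<close>,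
  whereas the equations alone do not, by \<open>\<psi>\<close>. Exchange between the coordinate
  forms of \<open>t\<close> and \<open>Gen\<close> reverses the implication.\<close>

lemma solution_zero_imp_Gen_zero:
  assumes F: "finite F" "closed_terms F" and t: "t \<in> F"
    and \<psi>: "\<forall>s\<in>F. residual \<psi> s = 0" "\<psi> t \<noteq> 0"
    and \<phi>: "\<forall>s\<in>F. residual \<phi> s = 0" "\<phi> t = 0"
  shows "\<phi> Gen = 0"
proof -
  obtain k where k: "\<And>t \<phi>. t \<in> F \<Longrightarrow> residual \<phi> t = lin_form F (k t) \<phi>"
    using finite_equations[OF F] by blast
  define \<delta> where "\<delta> v = (\<lambda>u. if u = v then 1 else 0 :: 'r)" for v :: "'r sol_term"
  have \<delta>: "lin_form F (\<delta> v) \<chi> = \<chi> v" if "v \<in> F" for v \<chi>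
    using lin_form_single[OF F(1) that, of \<chi> 1] by (simp add: \<delta>_def act_one)
  have Gen: "Gen \<in> F" using F(2) by (simp add: closed_terms_def)
  have eqs: "(\<forall>l\<in>k ` F. lin_form F l \<chi> = 0) \<longleftrightarrow> (\<forall>s\<in>F. residual \<chi> s = 0)" for \<chi>
    using k by auto
  have "lin_form F (\<delta> Gen) \<phi> = 0"
  proof (rule equations_exchange[OF F(1), of "k ` F"])
    show "\<forall>l\<in>k ` F. lin_form F l \<psi> = 0" "\<forall>l\<in>k ` F. lin_form F l \<phi> = 0"
      using \<psi>(1) \<phi>(1) eqs by blast+
    show "lin_form F (\<delta> t) \<psi> \<noteq> 0" "lin_form F (\<delta> t) \<phi> = 0"
      using \<psi>(2) \<phi>(2) \<delta>[OF t] by simp_all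
    fix \<chi> assume "\<forall>l\<in>k ` F. lin_form F l \<chi> = 0" "lin_form F (\<delta> Gen) \<chi> = 0"
    then show "lin_form F (\<delta> t) \<chi> = 0"
      using residual_unique[OF F(2) _ _ t, of \<chi>] eqs[of \<chi>] \<delta>[OF t] \<delta>[OF Gen] by simp
  qed
  then show ?thesis using \<delta>[OF Gen] by simp
qed

text \<open>
  Working modulo this filter amounts to computing in a reduced power of \<open>M\<close>.
\<close>

definition solutions :: "('r sol_term \<Rightarrow> 'm) filter" where
  "solutions = (INF t. principal {\<phi>. residual \<phi> t = 0})"

lemma eventually_residual: "eventually (\<lambda>\<phi>. residual \<phi> t = 0) solutions"
  unfolding solutions_def by (rule eventually_INF1[of t]) (auto simp: eventually_principal)

text \<open>Finitely many equations can be enlarged by supports to a finite closed system, where the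
  counting of equations applies.\<close>

lemma eventually_solutionsE:
  assumes "eventually P solutions"
  obtains F where "finite F" "closed_terms F" "\<And>\<phi>. \<forall>t\<in>F. residual \<phi> t = 0 \<Longrightarrow> P \<phi>"
proof -
  obtain X where X: "finite X" "eventually P (INF t\<in>X. principal {\<phi>. residual \<phi> t = 0})"
    using iffD1[OF eventually_INF assms[unfolded solutions_def]] by blast
  let ?F = "\<Union>t\<in>insert Gen X. support t"
  show thesis
  proof (rule that)
    show "finite ?F" using X(1) by (auto simp: finite_support)
    show "closed_terms ?F"
      by (rule closed_terms_UN) (simp_all add: closed_terms_support)
    show "P \<phi>" if "\<forall>t\<in>?F. residual \<phi> t = 0" for \<phi>
    proof -
      have "\<phi> \<in> (\<Inter>t\<in>X. {\<phi>. residual \<phi> t = 0})"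
        using that in_support by blast
      then show ?thesis
        using X by (simp add: INF_principal_finite eventually_principal)
    qed
  qed
qed

lemma filterlim_subst: "filterlim (\<lambda>\<phi> t. \<phi> (subst s t)) solutions solutions"
proof -
  \<comment> \<open>Substitution changes only the arguments of a solution term, so it carries the
    equation of \<open>t\<close> to that of \<open>subst s t\<close>; at \<open>Gen\<close> there is
    nothing to satisfy.\<close>
  have "residual (\<lambda>t. \<phi> (subst s t)) t = (if t = Gen then 0 else residual \<phi> (subst s t))" for \<phi> t
    by (cases t) (auto intro!: sum.cong)
  then have "eventually (\<lambda>\<phi>. residual (\<lambda>t. \<phi> (subst s t)) t = 0) solutions" for t
    using eventually_residual[of "subst s t"] by (simp add: eventually_mono)
  then have "filterlim (\<lambda>\<phi> t. \<phi> (subst s t)) (INF t. principal {\<phi>. residual \<phi> t = 0}) solutions"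
    by (simp add: filterlim_INF filterlim_principal)
  then show ?thesis
    unfolding solutions_def[symmetric] .
qed

section \<open>Equivalence of terms modulo the equations\<close>

definition equiv_terms :: "'r sol_term \<Rightarrow> 'r sol_term \<Rightarrow> bool" (infix "\<approx>" 50) where
  "s \<approx> t \<longleftrightarrow> eventually (\<lambda>\<phi>. \<phi> s = \<phi> t) solutions"

lemma equiv_terms_refl [simp]: "t \<approx> t"
  by (simp add: equiv_terms_def)

lemma equiv_terms_sym: "s \<approx> t \<Longrightarrow> t \<approx> s"
  unfolding equiv_terms_def by (simp add: eq_commute)

lemma equiv_terms_trans [trans]:
  assumes "r \<approx> s" "s \<approx> t"
  shows "r \<approx> t"
  using assms unfolding equiv_terms_def by eventually_elim simp

lemma equiv_terms_subst_right: "s \<approx> t \<Longrightarrow> subst r s \<approx> subst r t"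
  unfolding equiv_terms_def using filterlim_subst[of r] by (auto simp: filterlim_iff)

text \<open>Taking \<open>b\<close> to be zero also shows that substitution respects equivalence in its first argument.\<close>

lemma eventually_subst_sum:
  assumes "eventually (\<lambda>\<phi>. \<phi> c = \<phi> a + \<phi> b) solutions"
  shows "eventually (\<lambda>\<phi>. \<phi> (subst c t) = \<phi> (subst a t) + \<phi> (subst b t)) solutions"
proof (induction t)
  case Gen
  then show ?case using assms by simp
next
  case (Sol n P Q ws i)
  let ?S = "\<lambda>x k. Sol n P Q (map (subst x) ws) k"
  show ?case
  proof (cases "i < n \<and> nonsing n P")
    case True
    have ws: "eventually (\<lambda>\<phi>. \<forall>w\<in>set ws. \<phi> (subst c w) = \<phi> (subst a w) + \<phi> (subst b w)) solutions"
      using Sol by (intro eventually_ball_finite) auto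
    have res: "eventually (\<lambda>\<phi>. \<forall>k\<in>{..<n}. residual \<phi> (?S x k) = 0) solutions" for x
      by (intro eventually_ball_finite ballI eventually_residual finite_lessThan)
    show ?thesis
      using ws res[of a] res[of b] res[of c]
    proof eventually_elim
      case (elim \<phi>)
      have sol: "(\<Sum>k<n. act (\<phi> (?S x k)) (P k j)) = (\<Sum>l<length ws. act (\<phi> (subst x (ws ! l))) (Q l j))"
        if "j < n" "\<forall>k\<in>{..<n}. residual \<phi> (?S x k) = 0" for j x
        using that True by simp
      \<comment> \<open>The right-hand sides add up because the arguments do; uniqueness of
        solutions passes this on to the rows.\<close>
      have "\<phi> (?S c i) = \<phi> (?S a i) + \<phi> (?S b i)"
      proof (rule nonsing_unique[of n P "\<lambda>k. \<phi> (?S c k)" "\<lambda>k. \<phi> (?S a k) + \<phi> (?S b k)"])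
        show "(\<Sum>k<n. act (\<phi> (?S c k)) (P k j)) = (\<Sum>k<n. act (\<phi> (?S a k) + \<phi> (?S b k)) (P k j))"
          if "j < n" for j
          unfolding add_act sum.distrib sol[OF that elim(2)] sol[OF that elim(3)] sol[OF that elim(4)]
          unfolding sum.distrib[symmetric] add_act[symmetric]
          using elim(1) by (intro sum.cong) simp_all
      qed (use True in auto)
      then show ?case by simp
    qed
  next
    case False
    have zero: "eventually (\<lambda>\<phi>. \<phi> (?S x i) = 0) solutions" for x
      using eventually_residual[of "?S x i"] False by auto
    show ?thesis
      using zero[of a] zero[of b] zero[of c] by eventually_elim simp
  qed
qed

section \<open>The division ring of solution terms\<close>

text \<open>Scalar multiples and sums are solutions of \<open>1 \<times> 1\<close> systems with
  \<open>P = 1\<close>, so the term language needs no further constructors.\<close>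

definition scale_term :: "'r sol_term \<Rightarrow> 'r \<Rightarrow> 'r sol_term" where
  "scale_term t r = Sol 1 (\<lambda>_ _. 1) (\<lambda>_ _. r) [t] 0"

definition add_term :: "'r sol_term \<Rightarrow> 'r sol_term \<Rightarrow> 'r sol_term" where
  "add_term s t = Sol 1 (\<lambda>_ _. 1) (\<lambda>_ _. 1) [s, t] 0"

lemma nonsing_1: "nonsing (Suc 0) (\<lambda>_ _. 1)"
  by (simp add: nonsing_def act_one)

lemma eventually_scale_term: "eventually (\<lambda>\<phi>. \<phi> (scale_term t r) = act (\<phi> t) r) solutions"
  using eventually_residual[of "scale_term t r"] by (simp add: scale_term_def nonsing_1 act_one)

lemma eventually_add_term: "eventually (\<lambda>\<phi>. \<phi> (add_term s t) = \<phi> s + \<phi> t) solutions"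
  using eventually_residual[of "add_term s t"]
  by (simp add: add_term_def nonsing_1 act_one numeral_2_eq_2 lessThan_Suc add.commute)

lemma subst_scale_term: "subst s (scale_term t r) = scale_term (subst s t) r"
  by (simp add: scale_term_def)

lemma subst_add_term: "subst r (add_term s t) = add_term (subst r s) (subst r t)"
  by (simp add: add_term_def)

abbreviation zero_term :: "'r sol_term" where
  "zero_term \<equiv> scale_term Gen 0"

lemma eventually_zero_term: "eventually (\<lambda>\<phi>. \<phi> zero_term = 0) solutions"
  using eventually_scale_term[of Gen 0] by simp

lemma equiv_zero_iff: "t \<approx> zero_term \<longleftrightarrow> eventually (\<lambda>\<phi>. \<phi> t = 0) solutions"
proof
  assume "t \<approx> zero_term"
  then show "eventually (\<lambda>\<phi>. \<phi> t = 0) solutions"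
    using eventually_zero_term unfolding equiv_terms_def by eventually_elim simp
next
  assume "eventually (\<lambda>\<phi>. \<phi> t = 0) solutions"
  then show "t \<approx> zero_term"
    using eventually_zero_term unfolding equiv_terms_def by eventually_elim simp
qed

lemma subst_add_left: "subst (add_term a b) t \<approx> add_term (subst a t) (subst b t)"
  using eventually_subst_sum[OF eventually_add_term, of a b t] eventually_add_term[of "subst a t" "subst b t"]
  unfolding equiv_terms_def by eventually_elim simp

lemma equiv_terms_subst_left:
  assumes "a \<approx> b"
  shows "subst a t \<approx> subst b t"
proof -
  \<comment> \<open>The relation \<open>0 = 0 + 0\<close> survives substitution and forces the value
    at \<open>subst zero_term t\<close> to be zero.\<close>
  have "eventually (\<lambda>\<phi>. \<phi> (subst zero_term t) = \<phi> (subst zero_term t) + \<phi> (subst zero_term t)) solutions"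
  proof (rule eventually_subst_sum)
    show "eventually (\<lambda>\<phi>. \<phi> zero_term = \<phi> zero_term + \<phi> zero_term) solutions"
      using eventually_zero_term by eventually_elim simp
  qed
  moreover have "eventually (\<lambda>\<phi>. \<phi> (subst a t) = \<phi> (subst b t) + \<phi> (subst zero_term t)) solutions"
  proof (rule eventually_subst_sum)
    show "eventually (\<lambda>\<phi>. \<phi> a = \<phi> b + \<phi> zero_term) solutions"
      using assms eventually_zero_term unfolding equiv_terms_def by eventually_elim simp
  qed
  ultimately show ?thesis
    unfolding equiv_terms_def by eventually_elim simp
qed

lemma equiv_terms_subst: "a \<approx> b \<Longrightarrow> s \<approx> t \<Longrightarrow> subst a s \<approx> subst b t"
  using equiv_terms_subst_left equiv_terms_subst_right equiv_terms_trans by blast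

lemma equiv_terms_add:
  assumes "a \<approx> b" "s \<approx> t"
  shows "add_term a s \<approx> add_term b t"
  using assms eventually_add_term[of a s] eventually_add_term[of b t]
  unfolding equiv_terms_def by eventually_elim simp

lemma Gen_not_zero: "\<not> Gen \<approx> zero_term"
proof
  assume "Gen \<approx> zero_term"
  then obtain F where "finite F" "closed_terms F" "\<And>\<phi>. \<forall>t\<in>F. residual \<phi> t = 0 \<Longrightarrow> \<phi> Gen = 0"
    unfolding equiv_zero_iff using eventually_solutionsE by blast
  then show False using solution_Gen_nonzero by blast
qed

lemma right_inverse:
  assumes t: "\<not> t \<approx> zero_term"
  shows "\<exists>s. subst t s \<approx> Gen"
proof -
  let ?F = "support t"
  let ?n = "card ?F"
  have F: "finite ?F" "closed_terms ?F" "t \<in> ?F"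
    by (simp_all add: finite_support closed_terms_support in_support)
  then have Gen: "Gen \<in> ?F" by (simp add: closed_terms_def)
  have ev_sol: "eventually (\<lambda>\<phi>. \<forall>s\<in>?F. residual \<phi> s = 0) solutions"
    by (intro eventually_ball_finite ballI eventually_residual F(1))
  \<comment> \<open>Otherwise the finitely many equations on \<open>?F\<close> would already force
    \<open>t\<close> to be zero.\<close>
  have "\<exists>\<psi>. (\<forall>s\<in>?F. residual \<psi> s = 0) \<and> \<psi> t \<noteq> 0"
  proof (rule ccontr)
    assume none: "\<not> ?thesis"
    from ev_sol have "eventually (\<lambda>\<phi>. \<phi> t = 0) solutions"
      by (rule eventually_mono) (use none in blast)
    then show False using t equiv_zero_iff by simp
  qed
  then obtain \<psi> where \<psi>: "\<forall>s\<in>?F. residual \<psi> s = 0" "\<psi> t \<noteq> 0" by blast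
  obtain k where k: "\<And>s \<phi>. s \<in> ?F \<Longrightarrow> residual \<phi> s = lin_form ?F (k s) \<phi>"
    using finite_equations[OF F(1,2)] by blast
  obtain f where f: "bij_betw f {..<?n} ?F"
    using ex_bij_betw_nat_finite[OF F(1)] by (auto simp: atLeast0LessThan)
  have fF: "f i \<in> ?F" if "i < ?n" for i
    using bij_betwE[OF f] that by blast
  have surj: "\<exists>i<?n. f i = s" if "s \<in> ?F" for s
  proof -
    have "s \<in> f ` {..<?n}" using that bij_betw_imp_surj_on[OF f] by simp
    then show ?thesis by auto
  qed
  obtain i0 where i0: "i0 < ?n" "f i0 = Gen" using surj[OF Gen] by blast
  have lin: "(\<Sum>i<?n. act (\<phi> (f i)) (g (f i))) = lin_form ?F g \<phi>" for \<phi> g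
    unfolding lin_form_def using sum.reindex_bij_betw[OF f, of "\<lambda>v. act (\<phi> v) (g v)"] by simp
  \<comment> \<open>The equations on \<open>?F\<close> are indexed by its terms other than \<open>Gen\<close>; the free column receives the
    equation for the value at \<open>t\<close>, so that \<open>P\<close> recovers a solution from this value.\<close>
  define P where "P i j = (if f j = Gen then (if f i = t then 1 else 0) else k (f j) (f i))" for i j
  define Q where "Q l j = (if f j = Gen then 1 else 0 :: 'r)" for l j :: nat
  have P_Gen: "(\<Sum>i<?n. act (\<phi> (f i)) (P i j)) = \<phi> t" if "j < ?n" "f j = Gen" for \<phi> j
    using lin[of \<phi> "\<lambda>u. if u = t then 1 else 0"] lin_form_single[OF F(1,3), of \<phi> 1] that
    by (simp add: P_def act_one)
  have P_eq: "(\<Sum>i<?n. act (\<phi> (f i)) (P i j)) = residual \<phi> (f j)" if "j < ?n" "f j \<noteq> Gen" for \<phi> j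
    using lin[of \<phi> "k (f j)"] k[OF fF] that by (simp add: P_def)
  have P: "nonsing ?n P"
    unfolding nonsing_def
  proof (intro allI impI)
    fix a i assume a: "\<forall>j<?n. (\<Sum>i<?n. act (a i) (P i j)) = 0" and i: "i < ?n"
    define \<phi> where "\<phi> v = a (inv_into {..<?n} f v)" for v
    have \<phi>f: "\<phi> (f i) = a i" if "i < ?n" for i
      using bij_betw_inv_into_left[OF f] that by (simp add: \<phi>_def)
    have a': "(\<Sum>i<?n. act (\<phi> (f i)) (P i j)) = 0" if "j < ?n" for j
      using a that \<phi>f by simp
    have res: "\<forall>s\<in>?F. residual \<phi> s = 0"
    proof
      fix s assume "s \<in> ?F"
      then obtain j where "j < ?n" "f j = s" using surj by blast
      then show "residual \<phi> s = 0"
        using P_eq[of j \<phi>] a'[of j] by (cases "s = Gen") auto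
    qed
    have "\<phi> t = 0" using P_Gen[OF i0, of \<phi>] a'[OF i0(1)] by simp
    then have "\<phi> Gen = 0"
      using solution_zero_imp_Gen_zero[OF F \<psi> res] by blast
    then have "\<phi> (f i) = 0"
      using residual_unique[OF F(2) res] fF[OF i] by blast
    then show "a i = 0" using \<phi>f[OF i] by simp
  qed
  \<comment> \<open>The right-hand side of this system is \<open>t\<close> in the free column and
    zero elsewhere. The values on \<open>?F\<close> solve it too, so by uniqueness entry
    \<open>i0\<close> has the value of \<open>Gen\<close>.\<close>
  let ?S = "\<lambda>i. Sol ?n P Q [t] i"
  have "eventually (\<lambda>\<phi>. \<forall>i\<in>{..<?n}. residual \<phi> (?S i) = 0) solutions"
    by (intro eventually_ball_finite ballI eventually_residual finite_lessThan)
  with ev_sol have "eventually (\<lambda>\<phi>. \<phi> (?S i0) = \<phi> Gen) solutions"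
  proof eventually_elim
    case (elim \<phi>)
    have "\<phi> (?S i0) = \<phi> (f i0)"
    proof (rule nonsing_unique[OF P, of "\<lambda>i. \<phi> (?S i)" "\<lambda>i. \<phi> (f i)"])
      fix j assume j: "j < ?n"
      have "(\<Sum>i<?n. act (\<phi> (?S i)) (P i j)) = act (\<phi> t) (Q 0 j)"
        using elim(2) j P by simp
      also have "\<dots> = (\<Sum>i<?n. act (\<phi> (f i)) (P i j))"
        using P_Gen[of j \<phi>] P_eq[of j \<phi>] j elim(1) fF[OF j] by (simp add: Q_def act_one)
      finally show "(\<Sum>i<?n. act (\<phi> (?S i)) (P i j)) = (\<Sum>i<?n. act (\<phi> (f i)) (P i j))" .
    qed (rule i0(1))
    then show ?case using i0 by simp
  qed
  \<comment> \<open>With \<open>Gen\<close> in place of the argument \<open>t\<close>, the entry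
    becomes a term whose instance at \<open>t\<close> is \<open>?S i0\<close>.\<close>
  then have "subst t (Sol ?n P Q [Gen] i0) \<approx> Gen"
    by (simp add: equiv_terms_def)
  then show ?thesis ..
qed

text \<open>Chosen representatives replace equivalence classes, so the carrier remains a set of
  terms.\<close>

definition rep :: "'r sol_term \<Rightarrow> 'r sol_term" where
  "rep t = (SOME s. s \<approx> t)"

lemma rep_equiv: "rep t \<approx> t"
  unfolding rep_def by (rule someI[of _ t]) simp

lemma rep_eq_iff: "rep s = rep t \<longleftrightarrow> s \<approx> t"
proof
  assume "rep s = rep t"
  then show "s \<approx> t"
    using rep_equiv[of s] rep_equiv[of t] equiv_terms_sym equiv_terms_trans by metis
next
  assume "s \<approx> t"
  then have "(\<lambda>r. r \<approx> s) = (\<lambda>r. r \<approx> t)"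
    using equiv_terms_sym equiv_terms_trans by blast
  then show "rep s = rep t" by (simp add: rep_def)
qed

text \<open>
  The class of \<open>t\<close> is the element \<open>d\<close> with \<open>t = Gen d\<close>, so the product corresponds to substitution for \<open>Gen\<close>.
\<close>

definition term_ring :: "'r sol_term ring" where
  "term_ring = \<lparr>carrier = range rep, mult = \<lambda>s t. rep (subst s t), one = rep Gen,
     zero = rep zero_term, add = \<lambda>s t. rep (add_term s t)\<rparr>"

lemma term_ring_simps [simp]:
  "carrier term_ring = range rep"
  "mult term_ring (rep s) (rep t) = rep (subst s t)"
  "one term_ring = rep Gen"
  "zero term_ring = rep zero_term"
  "add term_ring (rep s) (rep t) = rep (add_term s t)"
  by (simp_all add: term_ring_def rep_eq_iff equiv_terms_subst equiv_terms_add rep_equiv)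

text \<open>Associativity and left distributivity hold syntactically, since substitution composes
  and commutes with term formation. Right distributivity rests on additivity of terms in
  \<open>Gen\<close>.\<close>

lemma ring_term_ring: "ring term_ring"
proof (intro ringI abelian_groupI monoidI)
  fix x assume "x \<in> carrier term_ring"
  then obtain t where t: "x = rep t" by auto
  have "add_term (scale_term t (- 1)) t \<approx> zero_term"
    unfolding equiv_zero_iff
    using eventually_add_term[of "scale_term t (- 1)" t] eventually_scale_term[of t "- 1"]
    by eventually_elim (simp add: act_minus_right act_one)
  then show "\<exists>y\<in>carrier term_ring. y \<oplus>\<^bsub>term_ring\<^esub> x = \<zero>\<^bsub>term_ring\<^esub>"
    using t by (intro bexI[of _ "rep (scale_term t (- 1))"]) (auto simp: rep_eq_iff)
next
  fix x y z assume "x \<in> carrier term_ring" "y \<in> carrier term_ring" "z \<in> carrier term_ring"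
  then obtain r s t where rst: "x = rep r" "y = rep s" "z = rep t" by auto
  have "add_term (add_term r s) t \<approx> add_term r (add_term s t)"
    unfolding equiv_terms_def
    using eventually_add_term[of r s] eventually_add_term[of s t]
      eventually_add_term[of "add_term r s" t] eventually_add_term[of r "add_term s t"]
    by eventually_elim (simp add: add.assoc)
  then show "x \<oplus>\<^bsub>term_ring\<^esub> y \<oplus>\<^bsub>term_ring\<^esub> z = x \<oplus>\<^bsub>term_ring\<^esub> (y \<oplus>\<^bsub>term_ring\<^esub> z)"
    using rst by (simp add: rep_eq_iff)
  show "x \<otimes>\<^bsub>term_ring\<^esub> y \<otimes>\<^bsub>term_ring\<^esub> z = x \<otimes>\<^bsub>term_ring\<^esub> (y \<otimes>\<^bsub>term_ring\<^esub> z)"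
    using rst by (simp add: subst_subst)
  show "(x \<oplus>\<^bsub>term_ring\<^esub> y) \<otimes>\<^bsub>term_ring\<^esub> z = x \<otimes>\<^bsub>term_ring\<^esub> z \<oplus>\<^bsub>term_ring\<^esub> y \<otimes>\<^bsub>term_ring\<^esub> z"
    using rst by (simp add: rep_eq_iff subst_add_left)
  show "z \<otimes>\<^bsub>term_ring\<^esub> (x \<oplus>\<^bsub>term_ring\<^esub> y) = z \<otimes>\<^bsub>term_ring\<^esub> x \<oplus>\<^bsub>term_ring\<^esub> z \<otimes>\<^bsub>term_ring\<^esub> y"
    using rst by (simp add: subst_add_term)
next
  fix x y assume "x \<in> carrier term_ring" "y \<in> carrier term_ring"
  then obtain s t where st: "x = rep s" "y = rep t" by auto
  have "add_term s t \<approx> add_term t s"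
    unfolding equiv_terms_def using eventually_add_term[of s t] eventually_add_term[of t s]
    by eventually_elim (simp add: add.commute)
  then show "x \<oplus>\<^bsub>term_ring\<^esub> y = y \<oplus>\<^bsub>term_ring\<^esub> x"
    using st by (simp add: rep_eq_iff)
next
  fix x assume "x \<in> carrier term_ring"
  then obtain t where t: "x = rep t" by auto
  have "add_term zero_term t \<approx> t"
    unfolding equiv_terms_def using eventually_add_term[of zero_term t] eventually_zero_term
    by eventually_elim simp
  then show "\<zero>\<^bsub>term_ring\<^esub> \<oplus>\<^bsub>term_ring\<^esub> x = x"
    using t by (simp add: rep_eq_iff)
qed auto

text \<open>Right inverses suffice: the right inverse \<open>y\<close> of \<open>x\<close> is
  nonzero and has a right inverse \<open>z\<close>, and associativity gives
  \<open>x = z\<close>.\<close>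

lemma skew_field_term_ring: "skew_field term_ring"
proof -
  interpret D: ring term_ring by (rule ring_term_ring)
  have ne: "\<one>\<^bsub>term_ring\<^esub> \<noteq> \<zero>\<^bsub>term_ring\<^esub>"
    using Gen_not_zero by (simp add: rep_eq_iff)
  have rinv: "\<exists>y\<in>carrier term_ring. x \<otimes>\<^bsub>term_ring\<^esub> y = \<one>\<^bsub>term_ring\<^esub>"
    if x: "x \<in> carrier term_ring" "x \<noteq> \<zero>\<^bsub>term_ring\<^esub>" for x
  proof -
    from x obtain t where t: "x = rep t" by auto
    then have "\<not> t \<approx> zero_term" using x by (simp add: rep_eq_iff)
    then obtain s where "subst t s \<approx> Gen" using right_inverse by blast
    then show ?thesis
      using t by (intro bexI[of _ "rep s"]) (auto simp: rep_eq_iff)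
  qed
  have "x \<in> Units term_ring" if x: "x \<in> carrier term_ring" "x \<noteq> \<zero>\<^bsub>term_ring\<^esub>" for x
  proof -
    obtain y where y: "y \<in> carrier term_ring" "x \<otimes>\<^bsub>term_ring\<^esub> y = \<one>\<^bsub>term_ring\<^esub>"
      using rinv[OF x] by blast
    then have "y \<noteq> \<zero>\<^bsub>term_ring\<^esub>" using x ne D.r_null by metis
    then obtain z where z: "z \<in> carrier term_ring" "y \<otimes>\<^bsub>term_ring\<^esub> z = \<one>\<^bsub>term_ring\<^esub>"
      using rinv y by blast
    have "x = z"
      using x y z D.m_assoc[of x y z] D.l_one D.r_one by metis
    then show ?thesis
      using x y z unfolding Units_def by blast
  qed
  moreover have "\<zero>\<^bsub>term_ring\<^esub> \<notin> Units term_ring"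
    using ne D.Units_l_inv_ex D.r_null by metis
  ultimately show ?thesis
    unfolding skew_field_def using D.ring_axioms D.Units_closed by blast
qed

section \<open>Embedding of the base ring\<close>

lemma scalar_injective:
  assumes "act b r \<noteq> 0" "act a r = 0"
  shows "a = 0"
proof -
  \<comment> \<open>This is exchange in one unknown \<open>x\<close> without equations:
    \<open>x = 0\<close> forces \<open>x r = 0\<close>, and \<open>b\<close> shows that
    \<open>x r = 0\<close> is not automatic.\<close>
  have "lin_form {()} (\<lambda>_. 1) (\<lambda>_. a) = 0"
    by (rule equations_exchange[of _ "{}" "\<lambda>_. b" "\<lambda>_. r"])
      (use assms in \<open>auto simp: lin_form_def act_one\<close>)
  then show ?thesis by (simp add: lin_form_def act_one)
qed

lemma embeddable_if_faithful:
  assumes "faithful_action act"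
  shows "embeddable_in_division_ring (class_ring :: 'r ring)"
proof (rule embeddable_in_division_ringI[OF class_ring.ring_axioms skew_field_term_ring])
  let ?h = "\<lambda>r. rep (scale_term Gen r)"
  show "?h \<in> Ring.ring_hom (class_ring :: 'r ring) term_ring"
  proof (rule ring_hom_memI)
    fix r s :: 'r
    have "scale_term Gen (r * s) \<approx> scale_term (scale_term Gen r) s"
      unfolding equiv_terms_def
      using eventually_scale_term[of Gen "r * s"] eventually_scale_term[of Gen r]
        eventually_scale_term[of "scale_term Gen r" s]
      by eventually_elim (simp add: act_mult)
    then show "?h (r \<otimes>\<^bsub>class_ring\<^esub> s) = ?h r \<otimes>\<^bsub>term_ring\<^esub> ?h s"
      by (simp add: rep_eq_iff subst_scale_term)
    have "scale_term Gen (r + s) \<approx> add_term (scale_term Gen r) (scale_term Gen s)"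
      unfolding equiv_terms_def
      using eventually_scale_term[of Gen "r + s"] eventually_scale_term[of Gen r]
        eventually_scale_term[of Gen s] eventually_add_term[of "scale_term Gen r" "scale_term Gen s"]
      by eventually_elim (simp add: act_add)
    then show "?h (r \<oplus>\<^bsub>class_ring\<^esub> s) = ?h r \<oplus>\<^bsub>term_ring\<^esub> ?h s"
      by (simp add: rep_eq_iff)
  next
    have "scale_term Gen 1 \<approx> Gen"
      unfolding equiv_terms_def using eventually_scale_term[of Gen 1]
      by eventually_elim (simp add: act_one)
    then show "?h \<one>\<^bsub>class_ring\<^esub> = \<one>\<^bsub>term_ring\<^esub>"
      by (simp add: rep_eq_iff)
  qed auto
  show "inj_on ?h (carrier (class_ring :: 'r ring))"
  proof (rule inj_onI)
    fix r s assume "?h r = ?h s"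
    then have "scale_term Gen r \<approx> scale_term Gen s" by (simp add: rep_eq_iff)
    then have ev: "eventually (\<lambda>\<phi>. act (\<phi> Gen) (r - s) = 0) solutions"
      using eventually_scale_term[of Gen r] eventually_scale_term[of Gen s]
      unfolding equiv_terms_def
      by eventually_elim (use act_add[of _ r "- s"] in \<open>simp add: act_minus_right\<close>)
    \<comment> \<open>If \<open>r - s\<close> acted nontrivially, it would act injectively, and
      \<open>Gen\<close> would be forced to be zero.\<close>
    have "act a (r - s) = 0" for a
    proof (rule ccontr)
      assume "act a (r - s) \<noteq> 0"
      from ev have "eventually (\<lambda>\<phi>. \<phi> Gen = 0) solutions"
        by (rule eventually_mono) (rule scalar_injective[OF \<open>act a (r - s) \<noteq> 0\<close>])
      then show False using Gen_not_zero equiv_zero_iff by simp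
    qed
    then have "r - s = 0" using assms unfolding faithful_action_def by blast
    then show "r = s" by simp
  qed
qed

end

theorem lemma8:
  fixes act :: "'m::ab_group_add \<Rightarrow> 'r::ring_1 \<Rightarrow> 'm"
  assumes "right_module act"
    and "\<exists>a::'m. a \<noteq> 0"
  shows
    "(\<forall>n. closure_operator_on (carrier_vec n) (cl act n) \<and>
          (\<forall>A. closed_subset (carrier_vec n) (cl act n) A \<longrightarrow> right_submodule n A)) \<and>
     (\<forall>n>0. right_submodule n (cl act n {}) \<and> cl act n {} \<noteq> carrier_vec n) \<and>
     (\<forall>m n h A. right_module_hom m n h \<and> right_submodule n A \<and>
        closed_subset (carrier_vec n) (cl act n) A \<longrightarrow>
        right_submodule m {x \<in> carrier_vec m. h x \<in> A} \<and>
        closed_subset (carrier_vec m) (cl act m) {x \<in> carrier_vec m. h x \<in> A}) \<and>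
     (\<forall>n. (exchange_property (carrier_vec n) (cl act n) \<longleftrightarrow> no_set_chain act n) \<and>
          (exchange_property (carrier_vec n) (cl act n) \<longleftrightarrow> no_added_column_chain act n) \<and>
          (exchange_property (carrier_vec n) (cl act n) \<longleftrightarrow> no_changed_column_chain act n)) \<and>
     (faithful_action act \<and>
        ((\<forall>n. no_set_chain act n) \<or> (\<forall>n. no_added_column_chain act n) \<or>
         (\<forall>n. no_changed_column_chain act n)) \<longrightarrow>
        embeddable_in_division_ring (class_ring :: 'r ring))"
proof -
  interpret right_module act by fact
  obtain w :: 'm where w: "w \<noteq> 0" using assms(2) by blast
  have closed: "right_submodule n A" if "closed_subset (carrier_vec n) (cl act n) A" for n A
    using that right_submodule_cl[of n A] by (simp add: closed_subset_def)
  have embed: "embeddable_in_division_ring (class_ring :: 'r ring)"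
    if "faithful_action act" "\<And>n. exchange_property (carrier_vec n) (cl act n)"
  proof -
    interpret exchange_module act by unfold_locales (use assms(2) that(2) in auto)
    show ?thesis using that(1) by (rule embeddable_if_faithful)
  qed
  have "faithful_action act \<and>
      ((\<forall>n. no_set_chain act n) \<or> (\<forall>n. no_added_column_chain act n) \<or>
       (\<forall>n. no_changed_column_chain act n)) \<longrightarrow>
      embeddable_in_division_ring (class_ring :: 'r ring)"
    using embed exchange_iff_no_set_chain exchange_iff_no_added_column_chain
      exchange_iff_no_changed_column_chain by metis
  then show ?thesis
    by (intro conjI allI impI closure_operator_on_cl closed right_submodule_cl cl_empty_proper[OF w]
        exchange_iff_no_set_chain exchange_iff_no_added_column_chain exchange_iff_no_changed_column_chain)
      (auto intro: right_submodule_vimage closed_subset_vimage)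
qed

end
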